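(* Let $a<b$, $n\in\mathbb{N}$, $\beta>0$, $\alpha_k\in(k-1,k)$ for $k\in\{1,\ldots,n\}$, and let $L:(x,y,v_1,\ldots,v_n,w,z)\mapsto L$ and $l:(x,y,v_1,\ldots,v_n,w)\mapsto l$ be real-valued functions of class $C^1$. For $y\in\mathcal{F}^n([a,b];\mathbb{R})$ put ${^C_aD_x^\alpha}y(x)=({^C_aD_x^{\alpha_1}}y(x),\ldots,{^C_aD_x^{\alpha_n}}y(x))$, $$z(x)=\int_a^x l\bigl(t,y(t),{^C_aD_t^\alpha}y(t),{_aI_t^\beta}y(t)\bigr)\,dt,$$ $\{y\}(x)=(x,y(x),{^C_aD_x^\alpha}y(x),{_aI_x^\beta}y(x))$, $[y](x)=(x,y(x),{^C_aD_x^\alpha}y(x),{_aI_x^\beta}y(x),z(x))$, and $$J(y)=\int_a^b L[y](x)\,dx.$$ If $y\in\mathcal{F}^n([a,b];\mathbb{R})$ is a minimizer of $J$ (with no boundary conditions imposed), then for all $x\in[a,b]$ $$\frac{\partial L}{\partial y}[y](x)+\sum_{k=1}^n{_xD^{\alpha_k}_b}\left(\frac{\partial L}{\partial v_k}[y](x)\right)+{_xI^\beta_b}\left(\frac{\partial L}{\partial w}[y](x)\right)+\int_x^b\frac{\partial L}{\partial z}[y](t)\,dt\cdot\frac{\partial l}{\partial y}\{y\}(x)$$ $$+\sum_{k=1}^n{_xD^{\alpha_k}_b}\left(\int_x^b\frac{\partial L}{\partial z}[y](t)\,dt\cdot\frac{\partial l}{\partial v_k}\{y\}(x)\right)+{_xI^\beta_b}\left(\int_x^b\frac{\partial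 L}{\partial z}[y](t)\,dt\cdot\frac{\partial l}{\partial w}\{y\}(x)\right)=0,$$ and $y$ satisfies the natural boundary conditions $$\sum_{m=k}^n\left[{_xD_b^{\alpha_m-k}}\left(\frac{\partial L}{\partial v_m}[y](x)+\int_x^b\frac{\partial L}{\partial z}[y](t)\,dt\cdot\frac{\partial l}{\partial v_m}\{y\}(x)\right)\right]_a^b=0\quad\text{for all }k\in\{1,\ldots,n\}.$$
   Context: For $\gamma>0$, the left and right Riemann--Liouville fractional integrals are ${_aI_x^\gamma}f(x)=\frac{1}{\Gamma(\gamma)}\int_a^x(x-t)^{\gamma-1}f(t)\,dt$ and ${_xI_b^\gamma}f(x)=\frac{1}{\Gamma(\gamma)}\int_x^b(t-x)^{\gamma-1}f(t)\,dt$. For $k\in\mathbb{N}$ and $\gamma\in(k-1,k)$, the right Riemann--Liouville fractional derivative is ${_xD_b^\gamma}f(x)=\frac{(-1)^k}{\Gamma(k-\gamma)}\frac{d^k}{dx^k}\int_x^b(t-x)^{k-\gamma-1}f(t)\,dt$; for negative order, ${_xD_b^{-\gamma}}={_xI_b^{\gamma}}$ ($\gamma>0$). The left Caputo fractional derivative of $f\in AC^k([a,b];\mathbb{R})$, of order $\gamma\in(k-1,k)$, is ${^C_aD_x^\gamma}f(x)=\frac{1}{\Gamma(k-\gamma)}\int_a^x(x-t)^{k-\gamma-1}f^{(k)}(t)\,dt$. Here $AC^k([a,b];\mathbb{R})$ is the space of functions with continuous derivatives up to order $k-1$ on $[a,b]$ whose $(k-1)$-th derivative is absolutely continuous. $\mathcal{F}^n([a,b];\mathbb{R})$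 denotes the class of functions $y\in AC^n([a,b];\mathbb{R})$ such that ${^C_aD_x^{\alpha_k}}y$, $k=1,\ldots,n$, and ${_aI_x^\beta}y$ exist and are continuous on $[a,b]$. Partial derivatives of $L$ are with respect to its named variables and are evaluated at $[y](\cdot)$; those of $l$ are evaluated at $\{y\}(\cdot)$. An expression such as ${_xD_b^\gamma}(\phi(x))$ means the operator applied to the function $\phi$, evaluated at $x$, and $[\phi(x)]_a^b=\phi(b)-\phi(a)$.
   Formalization: The equation is claimed at each x in [a,b] where the right Riemann–Liouville derivatives appearing in it exist, and the k-th natural boundary condition when its terms exist at a and b; such existence does not follow from the hypotheses. *)

theory Defs
  imports "HOL-Analysis.Analysis"
begin

text \<open>
  A function on \<open>[a, b]\<close> is a total function \<open>real \<Rightarrow> real\<close>; only its values on \<open>{a..b}\<close> matter.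
  Derivatives are taken within \<open>{a..b}\<close>, so they are one-sided at the end points.
  All integrals are Lebesgue integrals.
\<close>

primrec nderiv :: "real set \<Rightarrow> nat \<Rightarrow> (real \<Rightarrow> real) \<Rightarrow> real \<Rightarrow> real" where
  "nderiv S 0 f = f"
| "nderiv S (Suc k) f = (\<lambda>x. vector_derivative (nderiv S k f) (at x within S))"

text \<open>
  Existence of the \<open>k\<close>-th derivative at the single point \<open>x\<close>: the lower derivatives have to exist
  on a neighbourhood of \<open>x\<close> relative to \<open>S\<close>.
\<close>

primrec ntimes_differentiable_at :: "real set \<Rightarrow> nat \<Rightarrow> (real \<Rightarrow> real) \<Rightarrow> real \<Rightarrow> bool" where
  "ntimes_differentiable_at S 0 f x \<longleftrightarrow> True"
| "ntimes_differentiable_at S (Suc k) f x \<longleftrightarrow>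
     (\<forall>\<^sub>F u in nhds x. u \<in> S \<longrightarrow> ntimes_differentiable_at S k f u) \<and>
     nderiv S k f differentiable (at x within S)"

text \<open>\<open>D\<close> ranges over finite families of non-overlapping compact subintervals of \<open>[a, b]\<close>.\<close>

definition abs_continuous_on_interval :: "real \<Rightarrow> real \<Rightarrow> (real \<Rightarrow> real) \<Rightarrow> bool" where
  "abs_continuous_on_interval a b f \<longleftrightarrow>
     (\<forall>\<epsilon>>0. \<exists>\<delta>>0. \<forall>D T. D division_of T \<and> T \<subseteq> {a..b} \<and> (\<Sum>K\<in>D. Sup K - Inf K) < \<delta>
        \<longrightarrow> (\<Sum>K\<in>D. \<bar>f (Sup K) - f (Inf K)\<bar>) < \<epsilon>)"

text \<open>\<open>AC\<^sup>k([a, b])\<close>, for \<open>k \<ge> 1\<close>.\<close>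

definition AC :: "nat \<Rightarrow> real \<Rightarrow> real \<Rightarrow> (real \<Rightarrow> real) set" where
  "AC k a b = {f.
     (\<forall>j. Suc j < k \<longrightarrow> (\<forall>x\<in>{a..b}. nderiv {a..b} j f differentiable (at x within {a..b}))) \<and>
     (\<forall>j<k. continuous_on {a..b} (nderiv {a..b} j f)) \<and>
     abs_continuous_on_interval a b (nderiv {a..b} (k - 1) f)}"

definition rl_left_int :: "real \<Rightarrow> real \<Rightarrow> (real \<Rightarrow> real) \<Rightarrow> real \<Rightarrow> real" where
  "rl_left_int a \<gamma> f x =
     1 / Gamma \<gamma> * (LINT t:{a..x}|lebesgue. (x - t) powr (\<gamma> - 1) * f t)"

definition rl_left_int_exists :: "real \<Rightarrow> real \<Rightarrow> (real \<Rightarrow> real) \<Rightarrow> real \<Rightarrow> bool" where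
  "rl_left_int_exists a \<gamma> f x \<longleftrightarrow>
     set_integrable lebesgue {a..x} (\<lambda>t. (x - t) powr (\<gamma> - 1) * f t)"

definition rl_right_int :: "real \<Rightarrow> real \<Rightarrow> (real \<Rightarrow> real) \<Rightarrow> real \<Rightarrow> real" where
  "rl_right_int b \<gamma> f x =
     1 / Gamma \<gamma> * (LINT t:{x..b}|lebesgue. (t - x) powr (\<gamma> - 1) * f t)"

definition rl_right_int_exists :: "real \<Rightarrow> real \<Rightarrow> (real \<Rightarrow> real) \<Rightarrow> real \<Rightarrow> bool" where
  "rl_right_int_exists b \<gamma> f x \<longleftrightarrow>
     set_integrable lebesgue {x..b} (\<lambda>t. (t - x) powr (\<gamma> - 1) * f t)"

text \<open>
  The orders are non-integers: \<open>\<gamma> \<in> (k - 1, k)\<close> with \<open>k \<ge> 1\<close> gives \<open>k = nat \<lceil>\<gamma>\<rceil>\<close>, and a negative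
  order denotes a fractional integral.
\<close>

definition rl_right_deriv :: "real \<Rightarrow> real \<Rightarrow> real \<Rightarrow> (real \<Rightarrow> real) \<Rightarrow> real \<Rightarrow> real" where
  "rl_right_deriv a b \<gamma> f x =
     (if \<gamma> < 0 then rl_right_int b (- \<gamma>) f x
      else let k = nat \<lceil>\<gamma>\<rceil> in
        (- 1) ^ k / Gamma (real k - \<gamma>) *
        nderiv {a..b} k (\<lambda>u. LINT t:{u..b}|lebesgue. (t - u) powr (real k - \<gamma> - 1) * f t) x)"

definition rl_right_deriv_exists :: "real \<Rightarrow> real \<Rightarrow> real \<Rightarrow> (real \<Rightarrow> real) \<Rightarrow> real \<Rightarrow> bool" where
  "rl_right_deriv_exists a b \<gamma> f x \<longleftrightarrow>
     (if \<gamma> < 0 then rl_right_int_exists b (- \<gamma>) f x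
      else let k = nat \<lceil>\<gamma>\<rceil> in
        (\<forall>\<^sub>F u in nhds x. u \<in> {a..b} \<longrightarrow> rl_right_int_exists b (real k - \<gamma>) f u) \<and>
        ntimes_differentiable_at {a..b} k
          (\<lambda>u. LINT t:{u..b}|lebesgue. (t - u) powr (real k - \<gamma> - 1) * f t) x)"

definition caputo :: "real \<Rightarrow> real \<Rightarrow> real \<Rightarrow> (real \<Rightarrow> real) \<Rightarrow> real \<Rightarrow> real" where
  "caputo a b \<gamma> f x = (let k = nat \<lceil>\<gamma>\<rceil> in
     1 / Gamma (real k - \<gamma>) *
     (LINT t:{a..x}|lebesgue. (x - t) powr (real k - \<gamma> - 1) * nderiv {a..b} k f t))"

text \<open>
  For \<open>f \<in> AC\<^sup>k([a, b])\<close> the derivative of order \<open>k\<close> exists almost everywhere by Lebesgue's theorem,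
  so the first conjunct only makes explicit that the integrand is defined almost everywhere.
\<close>

definition caputo_exists :: "real \<Rightarrow> real \<Rightarrow> real \<Rightarrow> (real \<Rightarrow> real) \<Rightarrow> real \<Rightarrow> bool" where
  "caputo_exists a b \<gamma> f x \<longleftrightarrow> (let k = nat \<lceil>\<gamma>\<rceil> in
     (AE t in lebesgue. t \<in> {a..x} \<longrightarrow>
        nderiv {a..b} (k - 1) f differentiable (at t within {a..b})) \<and>
     set_integrable lebesgue {a..x}
       (\<lambda>t. (x - t) powr (real k - \<gamma> - 1) * nderiv {a..b} k f t))"

definition F_class ::
  "nat \<Rightarrow> real \<Rightarrow> real \<Rightarrow> (nat \<Rightarrow> real) \<Rightarrow> real \<Rightarrow> (real \<Rightarrow> real) set" where
  "F_class n a b \<alpha> \<beta> = {y \<in> AC n a b.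
     (\<forall>k\<in>{1..n}. (\<forall>x\<in>{a..b}. caputo_exists a b (\<alpha> k) y x) \<and>
                 continuous_on {a..b} (caputo a b (\<alpha> k) y)) \<and>
     (\<forall>x\<in>{a..b}. rl_left_int_exists a \<beta> y x) \<and>
     continuous_on {a..b} (rl_left_int a \<beta> y)}"

text \<open>
  The variables \<open>v\<^sub>1, \<dots>, v\<^sub>n\<close> form one vector in \<open>real ^ 'n\<close>. A bijection \<open>e\<close> from \<open>{1..n}\<close> onto the
  index type does the numbering: \<open>v\<^sub>k\<close> is \<open>v $ e k\<close>.
\<close>

definition caputo_vec ::
  "nat \<Rightarrow> (nat \<Rightarrow> 'n::finite) \<Rightarrow> real \<Rightarrow> real \<Rightarrow> (nat \<Rightarrow> real) \<Rightarrow> (real \<Rightarrow> real) \<Rightarrow> real \<Rightarrow> real ^ 'n"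
  where
  "caputo_vec n e a b \<alpha> y x = (\<Sum>k=1..n. caputo a b (\<alpha> k) y x *\<^sub>R axis (e k) 1)"

text \<open>\<open>{y}(x)\<close>, \<open>z(x)\<close>, \<open>[y](x)\<close> and \<open>J(y)\<close>.\<close>

definition brace ::
  "nat \<Rightarrow> (nat \<Rightarrow> 'n::finite) \<Rightarrow> real \<Rightarrow> real \<Rightarrow> (nat \<Rightarrow> real) \<Rightarrow> real \<Rightarrow> (real \<Rightarrow> real) \<Rightarrow> real
    \<Rightarrow> real \<times> real \<times> (real ^ 'n) \<times> real" where
  "brace n e a b \<alpha> \<beta> y x = (x, y x, caputo_vec n e a b \<alpha> y x, rl_left_int a \<beta> y x)"

definition z_fun ::
  "nat \<Rightarrow> (nat \<Rightarrow> 'n::finite) \<Rightarrow> real \<Rightarrow> real \<Rightarrow> (nat \<Rightarrow> real) \<Rightarrow> real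
    \<Rightarrow> (real \<times> real \<times> (real ^ 'n) \<times> real \<Rightarrow> real) \<Rightarrow> (real \<Rightarrow> real) \<Rightarrow> real \<Rightarrow> real" where
  "z_fun n e a b \<alpha> \<beta> l y x = (LINT t:{a..x}|lebesgue. l (brace n e a b \<alpha> \<beta> y t))"

definition bracket ::
  "nat \<Rightarrow> (nat \<Rightarrow> 'n::finite) \<Rightarrow> real \<Rightarrow> real \<Rightarrow> (nat \<Rightarrow> real) \<Rightarrow> real
    \<Rightarrow> (real \<times> real \<times> (real ^ 'n) \<times> real \<Rightarrow> real) \<Rightarrow> (real \<Rightarrow> real) \<Rightarrow> real
    \<Rightarrow> real \<times> real \<times> (real ^ 'n) \<times> real \<times> real" where
  "bracket n e a b \<alpha> \<beta> l y x =
     (x, y x, caputo_vec n e a b \<alpha> y x, rl_left_int a \<beta> y x, z_fun n e a b \<alpha> \<beta> l y x)"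

definition J_functional ::
  "nat \<Rightarrow> (nat \<Rightarrow> 'n::finite) \<Rightarrow> real \<Rightarrow> real \<Rightarrow> (nat \<Rightarrow> real) \<Rightarrow> real
    \<Rightarrow> (real \<times> real \<times> (real ^ 'n) \<times> real \<times> real \<Rightarrow> real)
    \<Rightarrow> (real \<times> real \<times> (real ^ 'n) \<times> real \<Rightarrow> real) \<Rightarrow> (real \<Rightarrow> real) \<Rightarrow> real" where
  "J_functional n e a b \<alpha> \<beta> L l y = (LINT x:{a..b}|lebesgue. L (bracket n e a b \<alpha> \<beta> l y x))"

definition C1_on :: "'a::euclidean_space set \<Rightarrow> ('a \<Rightarrow> real) \<Rightarrow> bool" where
  "C1_on S f \<longleftrightarrow> (\<exists>f' :: 'a \<Rightarrow> 'a \<Rightarrow>\<^sub>L real.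
     (\<forall>p\<in>S. (f has_derivative blinfun_apply (f' p)) (at p within S)) \<and> continuous_on S f')"

text \<open>The partial derivative of \<open>f\<close> at \<open>p\<close> with respect to the coordinate with unit vector \<open>u\<close>.\<close>

definition partial_deriv :: "'a::real_vector \<Rightarrow> ('a \<Rightarrow> real) \<Rightarrow> 'a \<Rightarrow> real" where
  "partial_deriv u f p = deriv (\<lambda>s. f (p + s *\<^sub>R u)) 0"

end

theory Submission
  imports Defs
begin

text \<open>
  Write \<open>G\<close>, \<open>A\<^sub>k\<close>, \<open>W\<close> for the derivatives of \<open>L\<close> with respect to \<open>y\<close>, \<open>v\<^sub>k\<close>, \<open>w\<close> plus
  \<open>\<integral>\<^sub>x\<^sup>b L\<^sub>z\<close> times those of \<open>l\<close>; they are continuous along a minimizer. Vary the minimizer by \<open>\<epsilon> h\<close>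
  with \<open>h\<close> of class \<open>C\<^sup>n\<close>. As the Caputo derivative of order \<open>\<alpha>\<^sub>k\<close> of \<open>h\<close> is the left fractional integral
  of order \<open>k - \<alpha>\<^sub>k\<close> of \<open>h\<^sup>(\<^sup>k\<^sup>)\<close>, Fubini's theorem turns the first variation into
  \<open>\<Sum>k\<le>n. \<integral> \<Psi>\<^sub>k h\<^sup>(\<^sup>k\<^sup>) = 0\<close>, where \<open>\<Psi>\<^sub>k\<close> is the right fractional integral of order \<open>k - \<alpha>\<^sub>k\<close> of \<open>A\<^sub>k\<close> for
  \<open>k \<ge> 1\<close> and \<open>\<Psi>\<^sub>0\<close> is \<open>G\<close> plus the right fractional integral of order \<open>\<beta>\<close> of \<open>W\<close>. Integration
  by parts with antiderivatives of the \<open>\<Psi>\<^sub>k\<close> needs no differentiability of them: with \<open>Q\<^sub>0 = \<Psi>\<^sub>0\<close> and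
  \<open>Q\<^sub>k\<^sub>+\<^sub>1(x) = \<Psi>\<^sub>k\<^sub>+\<^sub>1(x) + \<integral>\<^sub>x\<^sup>b Q\<^sub>k\<close> this gives \<open>Q\<^sub>n = 0\<close> and \<open>\<integral>\<^sub>a\<^sup>b Q\<^sub>k = 0\<close> for \<open>k < n\<close>. Differentiating
  \<open>Q\<^sub>n = 0\<close> as often as the \<open>\<Psi>\<^sub>k\<close> allow at a point yields the Euler--Lagrange equation from \<open>Q\<^sub>0\<close> and the
  natural boundary conditions from \<open>Q\<^sub>k\<close>, \<open>k \<ge> 1\<close>; each end point contributes zero separately.
\<close>

subsection \<open>Riemann--Liouville integrals of continuous functions\<close>

text \<open>For \<open>\<gamma> < 1\<close> the integrand blows up at \<open>x\<close>, but its
  primitive stays continuous there, so the fundamental theorem with derivatives taken only in the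
  interior covers every \<open>\<gamma> > 0\<close>.\<close>

lemma has_integral_powr_shift:
  fixes x b \<gamma> :: real
  assumes "\<gamma> > 0" "x \<le> b"
  shows "((\<lambda>t. (t - x) powr (\<gamma> - 1)) has_integral ((b - x) powr \<gamma> / \<gamma>)) {x..b}"
proof -
  have "((\<lambda>t. (t - x) powr (\<gamma> - 1)) has_integral ((b - x) powr \<gamma> / \<gamma> - (x - x) powr \<gamma> / \<gamma>)) {x..b}"
  proof (rule fundamental_theorem_of_calculus_interior)
    show "continuous_on {x..b} (\<lambda>t. (t - x) powr \<gamma> / \<gamma>)"
      using assms by (intro continuous_intros continuous_on_powr') auto
    show "((\<lambda>t. (t - x) powr \<gamma> / \<gamma>) has_vector_derivative (t - x) powr (\<gamma> - 1)) (at t)"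
      if "t \<in> {x<..<b}" for t
      using that assms
      by (auto intro!: derivative_eq_intros simp: has_real_derivative_iff_has_vector_derivative[symmetric])
  qed (use assms in auto)
  with assms show ?thesis by simp
qed

lemma absolutely_integrable_powr_shift_mult:
  fixes f :: "real \<Rightarrow> real"
  assumes "\<gamma> > 0" "continuous_on {x..b} f"
  shows "(\<lambda>t. (t - x) powr (\<gamma> - 1) * f t) absolutely_integrable_on {x..b}"
proof (cases "x \<le> b")
  case True
  have 1: "(\<lambda>t. (t - x) powr (\<gamma> - 1)) absolutely_integrable_on {x..b}"
    using has_integral_powr_shift[OF assms(1) True]
    by (intro nonnegative_absolutely_integrable_1) (auto simp: integrable_on_def)
  have "(\<lambda>t. f t * (t - x) powr (\<gamma> - 1)) absolutely_integrable_on {x..b}"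
  proof (rule absolutely_integrable_bounded_measurable_product_real[OF _ _ _ 1])
    show "bounded (f ` {x..b})"
      using assms by (intro compact_imp_bounded compact_continuous_image) auto
    show "f \<in> borel_measurable (lebesgue_on {x..b})"
      using assms by (intro continuous_imp_measurable_on_sets_lebesgue) auto
  qed auto
  then show ?thesis by (simp add: mult.commute)
qed auto

text \<open>Cutting \<open>f\<close> off by the indicator makes the integrand Borel measurable on
  the whole line. This gives access to affine substitution and, later, to Fubini's theorem for
  \<open>lborel\<close>.\<close>

lemma LINT_powr_shift_lborel:
  fixes f :: "real \<Rightarrow> real"
  assumes "continuous_on {x..b} f"
  shows "(LINT t:{x..b}|lebesgue. (t - x) powr (\<gamma> - 1) * f t)
       = (LINT t:{x..b}|lborel. (t - x) powr (\<gamma> - 1) * f t)"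
proof -
  have [measurable]: "(\<lambda>t. indicator {x..b} t *\<^sub>R f t) \<in> borel_measurable borel"
    using assms by (intro borel_measurable_continuous_on_indicator) auto
  have eq: "(\<lambda>t. indicator {x..b} t *\<^sub>R ((t - x) powr (\<gamma> - 1) * f t))
        = (\<lambda>t. (t - x) powr (\<gamma> - 1) * (indicator {x..b} t *\<^sub>R f t))"
    by (auto simp: fun_eq_iff)
  show ?thesis
    unfolding set_lebesgue_integral_def eq by (rule integral_completion) measurable
qed

text \<open>The substitution \<open>t = x + (b - x) * s\<close> moves \<open>x\<close> out of the
  domain of integration and out of the singular weight. What remains under the integral depends on
  \<open>x\<close> only through \<open>f\<close>.\<close>

lemma LINT_powr_shift_scale:
  fixes f :: "real \<Rightarrow> real"
  assumes "continuous_on {x..b} f" "x \<le> b" "\<gamma> > 0"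
  shows "(LINT t:{x..b}|lebesgue. (t - x) powr (\<gamma> - 1) * f t)
       = (b - x) powr \<gamma> * (LINT s:{0..1}|lborel. s powr (\<gamma> - 1) * f (x + (b - x) * s))"
\<comment> \<open>The substitution degenerates at \<open>x = b\<close>. There both sides are zero
  because \<open>0 powr r = 0\<close>.\<close>
proof (cases "x = b")
  case True
  have "(LINT t:{b..b}|lborel. (t - b) powr (\<gamma> - 1) * f t) = (LINT t:{b..b}|lborel. 0)"
    by (rule set_lebesgue_integral_cong) auto
  with True assms LINT_powr_shift_lborel[of x b f \<gamma>] show ?thesis by (simp add: set_lebesgue_integral_def)
next
  case False
  with assms have "x < b" by simp
  have "(LINT t:{x..b}|lborel. (t - x) powr (\<gamma> - 1) * f t)
     = \<bar>b - x\<bar> *\<^sub>R (\<integral>s. indicator {x..b} (x + (b - x) * s) *\<^sub>R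
          ((x + (b - x) * s - x) powr (\<gamma> - 1) * f (x + (b - x) * s)) \<partial>lborel)"
    unfolding set_lebesgue_integral_def using \<open>x < b\<close> by (intro lborel_integral_real_affine) auto
  also have "(\<lambda>s. indicator {x..b} (x + (b - x) * s) *\<^sub>R
          ((x + (b - x) * s - x) powr (\<gamma> - 1) * f (x + (b - x) * s)))
      = (\<lambda>s. (b - x) powr (\<gamma> - 1) * (indicator {0..1} s *\<^sub>R (s powr (\<gamma> - 1) * f (x + (b - x) * s))))"
  proof
    fix s
    have "x + (b - x) * s \<in> {x..b} \<longleftrightarrow> s \<in> {0..1}"
    proof -
      have "x + (b - x) * s \<le> b \<longleftrightarrow> (b - x) * s \<le> (b - x) * 1" by auto
      also have "\<dots> \<longleftrightarrow> s \<le> 1" using \<open>x < b\<close> by (subst mult_le_cancel_left_pos) auto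
      finally show ?thesis using \<open>x < b\<close> by (auto simp: zero_le_mult_iff)
    qed
    then show "indicator {x..b} (x + (b - x) * s) *\<^sub>R
          ((x + (b - x) * s - x) powr (\<gamma> - 1) * f (x + (b - x) * s)) =
        (b - x) powr (\<gamma> - 1) * (indicator {0..1} s *\<^sub>R (s powr (\<gamma> - 1) * f (x + (b - x) * s)))"
      using \<open>x < b\<close> by (auto simp: indicator_def powr_mult split: if_splits)
  qed
  also have "\<bar>b - x\<bar> *\<^sub>R (\<integral>s. (b - x) powr (\<gamma> - 1) * (indicator {0..1} s *\<^sub>R (s powr (\<gamma> - 1) * f (x + (b - x) * s))) \<partial>lborel)
     = (b - x) powr \<gamma> * (LINT s:{0..1}|lborel. s powr (\<gamma> - 1) * f (x + (b - x) * s))"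
    using \<open>x < b\<close> powr_add[of "b - x" 1 "\<gamma> - 1"] by (simp add: set_lebesgue_integral_def)
  finally show ?thesis using assms LINT_powr_shift_lborel[of x b f \<gamma>] by simp
qed

text \<open>After scaling, dominated convergence applies with the majorant
  \<open>M * s powr (\<gamma> - 1)\<close>, which is the same for all \<open>x\<close>. The
  prefactor \<open>(b - x) powr \<gamma>\<close> is continuous up to \<open>b\<close> since
  \<open>\<gamma> > 0\<close>.\<close>

lemma continuous_on_LINT_powr_shift:
  fixes f :: "real \<Rightarrow> real"
  assumes f: "continuous_on {a..b} f" and "\<gamma> > 0"
  shows "continuous_on {a..b} (\<lambda>x. LINT t:{x..b}|lebesgue. (t - x) powr (\<gamma> - 1) * f t)"
proof -
  have in_ab: "x + (b - x) * s \<in> {a..b}" if "x \<in> {a..b}" "s \<in> {0..1}" for x s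
  proof -
    have "(b - x) * s \<le> b - x" "0 \<le> (b - x) * s"
      using that by (auto intro!: mult_left_le)
    with that show ?thesis unfolding atLeastAtMost_iff by linarith
  qed
  obtain M where "\<forall>u\<in>f ` {a..b}. norm u \<le> M"
    using compact_imp_bounded[OF compact_continuous_image[OF f compact_Icc]]
    unfolding bounded_iff by blast
  then have M: "\<bar>f x\<bar> \<le> M" if "x \<in> {a..b}" for x
    using that by auto
  have "continuous_on {a..b} (\<lambda>x. LINT s:{0..1}|lborel. s powr (\<gamma> - 1) * f (x + (b - x) * s))"
    unfolding continuous_on_sequentially comp_def
  proof (intro allI ballI impI)
    fix X x assume x: "x \<in> {a..b}" and X: "(\<forall>n. X n \<in> {a..b}) \<and> X \<longlonglongrightarrow> x"
    have meas: "(\<lambda>s. indicator {0..1} s *\<^sub>R (s powr (\<gamma> - 1) * f (u + (b - u) * s))) \<in> borel_measurable lborel"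
      if "u \<in> {a..b}" for u
    proof -
      have "continuous_on {0..1} (\<lambda>s. f (u + (b - u) * s))"
        using that in_ab by (intro continuous_intros continuous_on_compose2[OF f]) auto
      then have [measurable]: "(\<lambda>s. indicator {0..1} s *\<^sub>R f (u + (b - u) * s)) \<in> borel_measurable borel"
        by (intro borel_measurable_continuous_on_indicator) auto
      have eq: "(\<lambda>s. indicator {0..1} s *\<^sub>R (s powr (\<gamma> - 1) * f (u + (b - u) * s)))
          = (\<lambda>s. s powr (\<gamma> - 1) * (indicator {0..1} s *\<^sub>R f (u + (b - u) * s)))"
        by (auto simp: fun_eq_iff)
      show ?thesis unfolding eq by measurable
    qed
    show "(\<lambda>n. LINT s:{0..1}|lborel. s powr (\<gamma> - 1) * f (X n + (b - X n) * s))
       \<longlonglongrightarrow> (LINT s:{0..1}|lborel. s powr (\<gamma> - 1) * f (x + (b - x) * s))"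
      unfolding set_lebesgue_integral_def
    proof (rule integral_dominated_convergence)
      have "(\<lambda>s::real. (s - 0) powr (\<gamma> - 1)) absolutely_integrable_on {0..1}"
        using has_integral_powr_shift[of \<gamma> 0 1] assms
        by (intro nonnegative_absolutely_integrable_1) (auto simp: integrable_on_def)
      then have "integrable lebesgue (\<lambda>s::real. indicator {0..1} s *\<^sub>R s powr (\<gamma> - 1))"
        by (simp add: set_integrable_def)
      then have "integrable lborel (\<lambda>s::real. indicator {0..1} s *\<^sub>R s powr (\<gamma> - 1))"
        by (subst (asm) integrable_completion) measurable
      then show "integrable lborel (\<lambda>s::real. M * (indicator {0..1} s *\<^sub>R s powr (\<gamma> - 1)))"
        by simp
      show "AE s in lborel. norm (indicator {0..1} s *\<^sub>R (s powr (\<gamma> - 1) * f (X n + (b - X n) * s)))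
          \<le> M * (indicator {0..1} s *\<^sub>R s powr (\<gamma> - 1))" for n
      proof (rule AE_I2)
        fix s :: real
        show "norm (indicator {0..1} s *\<^sub>R (s powr (\<gamma> - 1) * f (X n + (b - X n) * s)))
            \<le> M * (indicator {0..1} s *\<^sub>R s powr (\<gamma> - 1))"
          using M[OF in_ab[of "X n" s]] X
          by (cases "s \<in> {0..1}") (auto simp: abs_mult mult.commute[of M] intro!: mult_left_mono)
      qed
      show "AE s in lborel. (\<lambda>n. indicator {0..1} s *\<^sub>R (s powr (\<gamma> - 1) * f (X n + (b - X n) * s)))
          \<longlonglongrightarrow> indicator {0..1} s *\<^sub>R (s powr (\<gamma> - 1) * f (x + (b - x) * s))"
      proof (rule AE_I2)
        fix s :: real
        show "(\<lambda>n. indicator {0..1} s *\<^sub>R (s powr (\<gamma> - 1) * f (X n + (b - X n) * s)))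
          \<longlonglongrightarrow> indicator {0..1} s *\<^sub>R (s powr (\<gamma> - 1) * f (x + (b - x) * s))"
        proof (cases "s \<in> {0..1}")
          case True
          have "(\<lambda>n. f (X n + (b - X n) * s)) \<longlonglongrightarrow> f (x + (b - x) * s)"
            using X True x in_ab
            by (intro continuous_on_tendsto_compose[OF f]) (auto intro!: tendsto_intros)
          then show ?thesis by (intro tendsto_intros)
        qed auto
      qed
    qed (use meas x X in auto)
  qed
  then have "continuous_on {a..b} (\<lambda>x. (b - x) powr \<gamma> *
      (LINT s:{0..1}|lborel. s powr (\<gamma> - 1) * f (x + (b - x) * s)))"
    using assms by (intro continuous_intros continuous_on_powr') auto
  then show ?thesis
    by (rule continuous_on_eq)
       (use assms in \<open>auto intro!: LINT_powr_shift_scale[symmetric] continuous_on_subset[OF f]\<close>)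
qed

lemma rl_right_int_exists_continuous:
  assumes "continuous_on {a..b} f" "\<gamma> > 0" "x \<in> {a..b}"
  shows "rl_right_int_exists b \<gamma> f x"
  unfolding rl_right_int_exists_def using assms
  by (intro absolutely_integrable_powr_shift_mult) (auto intro: continuous_on_subset)

lemma continuous_on_rl_right_int:
  assumes "continuous_on {a..b} f" "\<gamma> > 0"
  shows "continuous_on {a..b} (rl_right_int b \<gamma> f)"
  unfolding rl_right_int_def [abs_def]
  by (intro continuous_intros continuous_on_LINT_powr_shift assms)

section \<open>Left-sided fractional integrals by reflection\<close>

lemma absolutely_integrable_powr_reflect_mult:
  fixes f :: "real \<Rightarrow> real"
  assumes "\<gamma> > 0" "continuous_on {a..x} f"
  shows "(\<lambda>t. (x - t) powr (\<gamma> - 1) * f t) absolutely_integrable_on {a..x}"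
proof -
  have "continuous_on {- x..- a} (\<lambda>t. f (- t))"
    by (intro continuous_on_compose2[OF assms(2)] continuous_intros) auto
  from absolutely_integrable_powr_shift_mult[OF assms(1) this]
  have "(\<lambda>t. (\<lambda>t. (x - t) powr (\<gamma> - 1) * f t) (- t)) absolutely_integrable_on {- x..- a}"
    by (simp add: add.commute)
  then show ?thesis
    using absolutely_integrable_reflect_real[where f = "\<lambda>t. (x - t) powr (\<gamma> - 1) * f t"] by blast
qed

text \<open>The map \<open>t \<mapsto> - t\<close> exchanges the two kinds of fractional integral,
  so continuity of the left one is inherited from the right one.\<close>

lemma rl_left_int_reflect:
  assumes "\<gamma> > 0" "continuous_on {a..x} f"
  shows "rl_left_int a \<gamma> f x = rl_right_int (- a) \<gamma> (\<lambda>t. f (- t)) (- x)"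
proof -
  have c: "continuous_on {- x..- a} (\<lambda>t. f (- t))"
    by (intro continuous_on_compose2[OF assms(2)] continuous_intros) auto
  have "(LINT t:{a..x}|lebesgue. (x - t) powr (\<gamma> - 1) * f t)
      = integral {a..x} (\<lambda>t. (x - t) powr (\<gamma> - 1) * f t)"
    using absolutely_integrable_powr_reflect_mult[OF assms] by (rule set_lebesgue_integral_eq_integral)
  also have "\<dots> = integral {- x..- a} (\<lambda>t. (x - (- t)) powr (\<gamma> - 1) * f (- t))"
    using Henstock_Kurzweil_Integration.integral_reflect_real[where f = "\<lambda>t. (x - t) powr (\<gamma> - 1) * f t"] by simp
  also have "\<dots> = integral {- x..- a} (\<lambda>t. (t - (- x)) powr (\<gamma> - 1) * f (- t))"
    by (simp add: add.commute)
  also have "\<dots> = (LINT t:{- x..- a}|lebesgue. (t - (- x)) powr (\<gamma> - 1) * f (- t))"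
    using absolutely_integrable_powr_shift_mult[OF assms(1) c]
    by (rule set_lebesgue_integral_eq_integral(2)[symmetric])
  finally show ?thesis by (simp add: rl_left_int_def rl_right_int_def)
qed

lemma rl_left_int_exists_continuous:
  assumes "continuous_on {a..b} f" "\<gamma> > 0" "x \<in> {a..b}"
  shows "rl_left_int_exists a \<gamma> f x"
  unfolding rl_left_int_exists_def using assms
  by (intro absolutely_integrable_powr_reflect_mult) (auto intro: continuous_on_subset)

lemma continuous_on_rl_left_int:
  assumes f: "continuous_on {a..b} f" and "\<gamma> > 0"
  shows "continuous_on {a..b} (rl_left_int a \<gamma> f)"
proof -
  have c: "continuous_on {- b..- a} (\<lambda>t. f (- t))"
    by (intro continuous_on_compose2[OF f] continuous_intros) auto
  have "continuous_on {a..b} (\<lambda>x. rl_right_int (- a) \<gamma> (\<lambda>t. f (- t)) (- x))"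
    by (intro continuous_on_compose2[OF continuous_on_rl_right_int[OF c]] continuous_intros assms) auto
  then show ?thesis
    by (rule continuous_on_eq)
       (use assms in \<open>auto intro!: rl_left_int_reflect[symmetric] continuous_on_subset[OF f]\<close>)
qed

section \<open>Fractional integration by parts\<close>

lemma LINT_powr_reflect_lborel:
  fixes f :: "real \<Rightarrow> real"
  assumes "continuous_on {a..x} f"
  shows "(LINT t:{a..x}|lebesgue. (x - t) powr (\<gamma> - 1) * f t)
       = (LINT t:{a..x}|lborel. (x - t) powr (\<gamma> - 1) * f t)"
proof -
  have [measurable]: "(\<lambda>t. indicator {a..x} t *\<^sub>R f t) \<in> borel_measurable borel"
    using assms by (intro borel_measurable_continuous_on_indicator) auto
  have eq: "(\<lambda>t. indicator {a..x} t *\<^sub>R ((x - t) powr (\<gamma> - 1) * f t))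
        = (\<lambda>t. (x - t) powr (\<gamma> - 1) * (indicator {a..x} t *\<^sub>R f t))"
    by (auto simp: fun_eq_iff)
  show ?thesis
    unfolding set_lebesgue_integral_def eq by (rule integral_completion) measurable
qed

lemma set_integrable_lborel_continuous:
  fixes f :: "real \<Rightarrow> real"
  assumes "continuous_on {a..b} f"
  shows "set_integrable lborel {a..b} f"
  unfolding set_integrable_def by (rule borel_integrable_compact) (use assms in auto)

text \<open>Up to the factor \<open>Gamma \<gamma>\<close>, both sides are iterated integrals of
  \<open>A x * (x - t) powr (\<gamma> - 1) * h t\<close> over the triangle
  \<open>a \<le> t \<le> x \<le> b\<close>, so Fubini's theorem identifies them.\<close>

lemma integral_mult_rl_left_int:
  assumes A: "continuous_on {a..b} A" and h: "continuous_on {a..b} h" and g: "\<gamma> > 0"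
  shows "integral {a..b} (\<lambda>x. A x * rl_left_int a \<gamma> h x)
       = integral {a..b} (\<lambda>t. rl_right_int b \<gamma> A t * h t)"
proof -
  have g0: "Gamma \<gamma> \<noteq> 0" using Gamma_real_pos[OF g] by linarith
  define A' where "A' = (\<lambda>x. indicator {a..b} x *\<^sub>R A x)"
  define h' where "h' = (\<lambda>x. indicator {a..b} x *\<^sub>R h x)"
  have [measurable]: "A' \<in> borel_measurable borel" "h' \<in> borel_measurable borel"
    unfolding A'_def h'_def using A h by (intro borel_measurable_continuous_on_indicator; simp)+
  \<comment> \<open>The kernel is extended by zero to the plane. \<open>K_left\<close> and
    \<open>K_right\<close> read off its sections, which are the integrands of the left and of the
    right fractional integral.\<close>
  define K where "K = (\<lambda>(x, t). (if t \<le> x then (x - t) powr (\<gamma> - 1) else 0) * A' x * h' t)"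
  have K_left: "K (x, t) = A' x * (indicator {a..x} t *\<^sub>R ((x - t) powr (\<gamma> - 1) * h t))" for x t
    by (auto simp: K_def A'_def h'_def indicator_def)
  have K_right: "K (x, t) = h' t * (indicator {t..b} x *\<^sub>R ((x - t) powr (\<gamma> - 1) * A x))" for x t
    by (auto simp: K_def A'_def h'_def indicator_def)
  have int_left: "(\<integral>t. indicator {a..x} t *\<^sub>R ((x - t) powr (\<gamma> - 1) * f t) \<partial>lborel) = Gamma \<gamma> * rl_left_int a \<gamma> f x"
    if "x \<in> {a..b}" "continuous_on {a..b} f" for x f
    using LINT_powr_reflect_lborel[of a x f \<gamma>] that g0
    by (simp add: rl_left_int_def set_lebesgue_integral_def continuous_on_subset[OF that(2)])
  have int_right: "(\<integral>x. indicator {t..b} x *\<^sub>R ((x - t) powr (\<gamma> - 1) * A x) \<partial>lborel) = Gamma \<gamma> * rl_right_int b \<gamma> A t"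
    if "t \<in> {a..b}" for t
    using LINT_powr_shift_lborel[of t b A \<gamma>] that g0
    by (simp add: rl_right_int_def set_lebesgue_integral_def continuous_on_subset[OF A])
  have [measurable]: "K \<in> borel_measurable (lborel \<Otimes>\<^sub>M lborel)" unfolding K_def by measurable
  have "integrable (lborel \<Otimes>\<^sub>M lborel) K"
  proof (rule lborel_pair.Fubini_integrable)
    \<comment> \<open>Integrating the absolute kernel in \<open>t\<close> gives a left fractional
      integral of \<open>\<bar>h t\<bar>\<close>. It is continuous on \<open>{a..b}\<close>, which
      supplies the integrability that Fubini's theorem requires.\<close>
    have "integrable lborel (\<lambda>x. indicator {a..b} x *\<^sub>R (\<bar>A x\<bar> * (Gamma \<gamma> * rl_left_int a \<gamma> (\<lambda>t. \<bar>h t\<bar>) x)))"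
      using assms by (intro set_integrable_lborel_continuous[unfolded set_integrable_def] continuous_intros
        continuous_on_rl_left_int)
    also have "(\<lambda>x. indicator {a..b} x *\<^sub>R (\<bar>A x\<bar> * (Gamma \<gamma> * rl_left_int a \<gamma> (\<lambda>t. \<bar>h t\<bar>) x)))
        = (\<lambda>x. \<integral>t. norm (K (x, t)) \<partial>lborel)"
    proof
      fix x
      show "indicator {a..b} x *\<^sub>R (\<bar>A x\<bar> * (Gamma \<gamma> * rl_left_int a \<gamma> (\<lambda>t. \<bar>h t\<bar>) x)) = (\<integral>t. norm (K (x, t)) \<partial>lborel)"
      proof (cases "x \<in> {a..b}")
        case True
        have "(\<lambda>t. norm (K (x, t))) = (\<lambda>t. \<bar>A x\<bar> * (indicator {a..x} t *\<^sub>R ((x - t) powr (\<gamma> - 1) * \<bar>h t\<bar>)))"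
          using True by (auto simp: K_left abs_mult A'_def)
        with int_left[OF True, of "\<lambda>t. \<bar>h t\<bar>"] True h show ?thesis by (simp add: continuous_on_rabs)
      qed (simp add: K_left A'_def)
    qed
    finally show "integrable lborel (\<lambda>x. \<integral>t. norm (K (x, t)) \<partial>lborel)" .
    show "AE x in lborel. integrable lborel (\<lambda>t. K (x, t))"
    proof (rule AE_I2)
      fix x
      show "integrable lborel (\<lambda>t. K (x, t))"
      proof (cases "x \<in> {a..b}")
        case True
        have "integrable lebesgue (\<lambda>t. indicator {a..x} t *\<^sub>R ((x - t) powr (\<gamma> - 1) * h t))"
          using absolutely_integrable_powr_reflect_mult[OF g, of a x h] True h
            continuous_on_subset[OF h, of "{a..x}"] by (auto simp: set_integrable_def)
        then have "integrable lebesgue (\<lambda>t. K (x, t))" unfolding K_left by simp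
        moreover have "(\<lambda>t. K (x, t)) \<in> borel_measurable lborel" by measurable
        ultimately show ?thesis by (simp add: integrable_completion)
      qed (simp add: K_left A'_def)
    qed
  qed measurable
  then have "(\<integral>t. \<integral>x. K (x, t) \<partial>lborel \<partial>lborel) = (\<integral>x. \<integral>t. K (x, t) \<partial>lborel \<partial>lborel)"
    by (intro lborel_pair.Fubini_integral) (simp add: case_prod_beta)
  moreover have "(\<lambda>t. \<integral>x. K (x, t) \<partial>lborel) = (\<lambda>t. Gamma \<gamma> * (indicator {a..b} t *\<^sub>R (rl_right_int b \<gamma> A t * h t)))"
  proof
    fix t
    show "(\<integral>x. K (x, t) \<partial>lborel) = Gamma \<gamma> * (indicator {a..b} t *\<^sub>R (rl_right_int b \<gamma> A t * h t))"
      using int_right[of t] by (cases "t \<in> {a..b}") (simp_all add: K_right h'_def)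
  qed
  moreover have "(\<lambda>x. \<integral>t. K (x, t) \<partial>lborel) = (\<lambda>x. Gamma \<gamma> * (indicator {a..b} x *\<^sub>R (A x * rl_left_int a \<gamma> h x)))"
  proof
    fix x
    show "(\<integral>t. K (x, t) \<partial>lborel) = Gamma \<gamma> * (indicator {a..b} x *\<^sub>R (A x * rl_left_int a \<gamma> h x))"
      using int_left[OF _ h, of x] by (cases "x \<in> {a..b}") (simp_all add: K_left A'_def)
  qed
  ultimately have "(LINT t:{a..b}|lborel. rl_right_int b \<gamma> A t * h t) = (LINT x:{a..b}|lborel. A x * rl_left_int a \<gamma> h x)"
    using g0 by (simp add: set_lebesgue_integral_def)
  then show ?thesis
    using assms
    by (simp add: set_borel_integral_eq_integral(2) set_integrable_lborel_continuous continuous_on_mult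
        continuous_on_rl_right_int continuous_on_rl_left_int)
qed

subsection \<open>The du Bois-Reymond lemma for higher derivatives\<close>

text \<open>The primitive \<open>integral {x..b} f\<close> vanishes at \<open>b\<close>, so only the
  boundary term at \<open>a\<close> survives. The derivative falls on \<open>h\<close>, and
  continuity of \<open>f\<close> suffices.\<close>

lemma integral_mult_backward_by_parts:
  fixes f h h' :: "real \<Rightarrow> real"
  assumes "a \<le> b" and f: "continuous_on {a..b} f" and h': "continuous_on {a..b} h'"
    and h: "\<And>x. x \<in> {a..b} \<Longrightarrow> (h has_vector_derivative h' x) (at x within {a..b})"
  shows "integral {a..b} (\<lambda>x. f x * h x)
       = integral {a..b} f * h a + integral {a..b} (\<lambda>x. integral {x..b} f * h' x)"
proof -
  have hc: "continuous_on {a..b} h"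
    by (rule continuous_on_vector_derivative) (use h in auto)
  have Rc: "continuous_on {a..b} (\<lambda>x. integral {x..b} f)"
    using f by (intro indefinite_integral_continuous_1' integrable_continuous_real)
  have "((\<lambda>x. integral {x..b} f * h' x + - f x * h x) has_integral
         (integral {b..b} f * h b - integral {a..b} f * h a)) {a..b}"
    using assms(1) h integral_has_vector_derivative'[OF f]
    by (intro fundamental_theorem_of_calculus has_vector_derivative_mult) auto
  then have "integral {a..b} (\<lambda>x. integral {x..b} f * h' x - f x * h x) = - integral {a..b} f * h a"
    by (simp add: integral_unique)
  moreover have "integral {a..b} (\<lambda>x. integral {x..b} f * h' x - f x * h x)
      = integral {a..b} (\<lambda>x. integral {x..b} f * h' x) - integral {a..b} (\<lambda>x. f x * h x)"
    using f h' hc Rc by (intro integral_diff integrable_continuous_real continuous_intros)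
  ultimately show ?thesis by simp
qed

text \<open>The coefficient of the \<open>k\<close>-th derivative of the test function in
  \<open>\<integral> \<Psi>\<^sub>0 h + \<Psi>\<^sub>1 h' + \<dots>\<close> after the lower order terms have been integrated by parts into it.\<close>

primrec accumulated_coeff :: "real \<Rightarrow> (nat \<Rightarrow> real \<Rightarrow> real) \<Rightarrow> nat \<Rightarrow> real \<Rightarrow> real" where
  "accumulated_coeff b \<Psi> 0 = \<Psi> 0"
| "accumulated_coeff b \<Psi> (Suc k) = (\<lambda>x. \<Psi> (Suc k) x + integral {x..b} (accumulated_coeff b \<Psi> k))"

lemma continuous_on_accumulated_coeff:
  assumes "\<And>k. k \<le> n \<Longrightarrow> continuous_on {a..b} (\<Psi> k)" "m \<le> n"
  shows "continuous_on {a..b} (accumulated_coeff b \<Psi> m)"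
  using assms(2)
  by (induction m)
     (auto intro!: continuous_intros assms(1) indefinite_integral_continuous_1' integrable_continuous_real)

text \<open>Each induction step integrates the leading term by parts once: its coefficient is
  absorbed into that of the next derivative, and one boundary term at \<open>a\<close> is left
  behind.\<close>

lemma sum_integral_accumulated_coeff:
  fixes \<Psi> H :: "nat \<Rightarrow> real \<Rightarrow> real"
  assumes "a \<le> b" and \<Psi>: "\<And>k. k \<le> n \<Longrightarrow> continuous_on {a..b} (\<Psi> k)"
    and H: "\<And>k. k \<le> n \<Longrightarrow> continuous_on {a..b} (H k)"
    and H': "\<And>k x. k < n \<Longrightarrow> x \<in> {a..b} \<Longrightarrow> (H k has_vector_derivative H (Suc k) x) (at x within {a..b})"
    and "m \<le> n"
  shows "(\<Sum>k\<le>m. integral {a..b} (\<lambda>x. \<Psi> k x * H k x))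
       = integral {a..b} (\<lambda>x. accumulated_coeff b \<Psi> m x * H m x)
         + (\<Sum>k<m. integral {a..b} (accumulated_coeff b \<Psi> k) * H k a)"
  using \<open>m \<le> n\<close>
proof (induction m)
  case (Suc m)
  let ?Q = "accumulated_coeff b \<Psi>"
  have c: "continuous_on {a..b} (?Q m)"
    using Suc \<Psi> by (intro continuous_on_accumulated_coeff[where n = n]) auto
  have "integral {a..b} (\<lambda>x. ?Q m x * H m x)
      = integral {a..b} (?Q m) * H m a + integral {a..b} (\<lambda>x. integral {x..b} (?Q m) * H (Suc m) x)"
    using Suc assms by (intro integral_mult_backward_by_parts c) auto
  moreover have "integral {a..b} (\<lambda>x. ?Q (Suc m) x * H (Suc m) x)
     = integral {a..b} (\<lambda>x. \<Psi> (Suc m) x * H (Suc m) x)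
       + integral {a..b} (\<lambda>x. integral {x..b} (?Q m) * H (Suc m) x)"
    unfolding accumulated_coeff.simps distrib_right
    using Suc \<Psi> H c
    by (intro integral_add integrable_continuous_real continuous_intros indefinite_integral_continuous_1') auto
  ultimately show ?case using Suc by simp
qed simp

text \<open>The values \<open>H k a\<close> with \<open>k < n\<close> and the top function
  \<open>H n\<close> can be prescribed independently. Choosing them equal to their own coefficients
  makes the vanishing sum a sum of squares. This is where the absence of boundary conditions
  enters.\<close>

lemma higher_order_du_Bois_Reymond:
  fixes \<Psi> :: "nat \<Rightarrow> real \<Rightarrow> real"
  assumes "a < b" and \<Psi>: "\<And>k. k \<le> n \<Longrightarrow> continuous_on {a..b} (\<Psi> k)"
    and zero: "\<And>H. (\<And>k. k \<le> n \<Longrightarrow> continuous_on {a..b} (H k)) \<Longrightarrow>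
       (\<And>k x. k < n \<Longrightarrow> x \<in> {a..b} \<Longrightarrow> (H k has_vector_derivative H (Suc k) x) (at x within {a..b})) \<Longrightarrow>
       (\<Sum>k\<le>n. integral {a..b} (\<lambda>x. \<Psi> k x * H k x)) = 0"
  shows "x \<in> {a..b} \<Longrightarrow> accumulated_coeff b \<Psi> n x = 0"
    and "k < n \<Longrightarrow> integral {a..b} (accumulated_coeff b \<Psi> k) = 0"
proof -
  define Q where "Q = accumulated_coeff b \<Psi>"
  have Q: "continuous_on {a..b} (Q k)" if "k \<le> n" for k
    unfolding Q_def using that \<Psi> by (intro continuous_on_accumulated_coeff[where n = n])
  text \<open>The test function with \<open>n\<close>-th derivative \<open>Q n\<close> and initial values \<open>\<integral> Q k\<close> turns the
    variation into a sum of squares.\<close>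
  define T :: "nat \<Rightarrow> real \<Rightarrow> real" where
    "T = rec_nat (Q n) (\<lambda>j t x. integral {a..b} (Q (n - Suc j)) + integral {a..x} t)"
  have T0: "T 0 = Q n"
    and TS: "T (Suc j) = (\<lambda>x. integral {a..b} (Q (n - Suc j)) + integral {a..x} (T j))" for j
    by (simp_all add: T_def)
  have Tc: "continuous_on {a..b} (T j)" for j
    by (induction j) (auto simp: T0 TS intro!: continuous_intros Q indefinite_integral_continuous_1
         integrable_continuous_real)
  \<comment> \<open>\<open>T\<close> counts integrations starting from \<open>Q n\<close>, while
    \<open>H\<close> counts derivatives, hence the reversed index.\<close>
  define H where "H k = T (n - k)" for k
  have Hn: "H n = Q n" by (simp add: H_def T0)
  have Ha: "H k a = integral {a..b} (Q k)" if "k < n" for k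
    using that by (simp add: H_def TS flip: Suc_diff_Suc)
  have Hc: "continuous_on {a..b} (H k)" for k by (simp add: H_def Tc)
  have H': "(H k has_vector_derivative H (Suc k) x) (at x within {a..b})" if "k < n" "x \<in> {a..b}" for k x
  proof -
    have "H k = (\<lambda>x. integral {a..b} (Q k) + integral {a..x} (H (Suc k)))"
      using that(1) by (simp add: H_def TS flip: Suc_diff_Suc)
    then show ?thesis
      using integral_has_vector_derivative[OF Hc that(2), of "Suc k"]
      by (auto intro!: derivative_eq_intros)
  qed
  have "0 = integral {a..b} (\<lambda>x. Q n x * H n x) + (\<Sum>k<n. integral {a..b} (Q k) * H k a)"
    unfolding Q_def
    using sum_integral_accumulated_coeff[of a b n \<Psi> H n] zero[of H] \<Psi> Hc H' assms(1) by simp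
  also have "\<dots> = integral {a..b} (\<lambda>x. (Q n x)\<^sup>2) + (\<Sum>k<n. (integral {a..b} (Q k))\<^sup>2)"
    by (simp add: Hn Ha power2_eq_square)
  finally have sum0: "integral {a..b} (\<lambda>x. (Q n x)\<^sup>2) + (\<Sum>k<n. (integral {a..b} (Q k))\<^sup>2) = 0" by simp
  have "integral {a..b} (\<lambda>x. (Q n x)\<^sup>2) \<ge> 0"
    by (intro integral_nonneg integrable_continuous_real continuous_intros Q) auto
  moreover have "(\<Sum>k<n. (integral {a..b} (Q k))\<^sup>2) \<ge> 0" by (intro sum_nonneg) auto
  ultimately have 1: "integral {a..b} (\<lambda>x. (Q n x)\<^sup>2) = 0" and 2: "(\<Sum>k<n. (integral {a..b} (Q k))\<^sup>2) = 0"
    using sum0 by linarith+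
  from 2 show "k < n \<Longrightarrow> integral {a..b} (accumulated_coeff b \<Psi> k) = 0"
    by (simp add: sum_nonneg_eq_0_iff Q_def)
  have "\<forall>x\<in>{a..b}. (Q n x)\<^sup>2 = 0"
    using 1 assms(1) by (subst (asm) integral_eq_0_iff) (auto intro!: continuous_intros Q)
  then show "x \<in> {a..b} \<Longrightarrow> accumulated_coeff b \<Psi> n x = 0" by (simp add: Q_def)
qed

section \<open>Iterated derivatives within a compact interval\<close>

lemma at_within_Icc_neq_bot:
  fixes a b x :: real
  assumes "a < b" "x \<in> {a..b}"
  shows "at x within {a..b} \<noteq> bot"
  using assms by (simp add: islimpt_Icc trivial_limit_within)

lemma eventually_at_within_nhds:
  assumes "\<forall>\<^sub>F u in nhds x. u \<in> S \<longrightarrow> P u"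
  shows "\<forall>\<^sub>F u in at x within S. P u"
  using assms by (auto simp: eventually_at_filter elim: eventually_mono)

lemma has_vector_derivative_transform_eventually:
  fixes f g :: "real \<Rightarrow> real"
  assumes "(f has_vector_derivative D) (at x within S)" "x \<in> S"
    "\<forall>\<^sub>F u in nhds x. u \<in> S \<longrightarrow> f u = g u"
  shows "(g has_vector_derivative D) (at x within S)"
proof -
  have "f x = g x" using eventually_nhds_x_imp_x[OF assms(3)] assms(2) by simp
  with assms eventually_at_within_nhds[OF assms(3)] show ?thesis
    unfolding has_vector_derivative_def by (intro has_derivative_transform_eventually[OF assms(1)[unfolded has_vector_derivative_def]])
qed

text \<open>Downward induction from \<open>k = n\<close>: the identity for \<open>Suc k\<close>
  holds near \<open>x\<close> relative to \<open>{a..b}\<close>, and differentiating it at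
  \<open>x\<close> gives the one for \<open>k\<close>, because \<open>integral {u..b}\<close> of the
  \<open>k\<close>-th coefficient has derivative minus that coefficient. The neighbourhoods in
  \<open>ntimes_differentiable_at\<close> are what permits this.\<close>

lemma accumulated_coeff_nderiv:
  assumes ab: "a < b" and \<Psi>: "\<And>k. k \<le> n \<Longrightarrow> continuous_on {a..b} (\<Psi> k)"
    and zero: "\<And>x. x \<in> {a..b} \<Longrightarrow> accumulated_coeff b \<Psi> n x = 0"
    and "k \<le> n" "x \<in> {a..b}"
    and "\<And>m. m \<in> {k<..n} \<Longrightarrow> ntimes_differentiable_at {a..b} (m - k) (\<Psi> m) x"
  shows "accumulated_coeff b \<Psi> k x + (\<Sum>m\<in>{k<..n}. (-1) ^ (m - k) * nderiv {a..b} (m - k) (\<Psi> m) x) = 0"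
  using assms(4-6)
proof (induction k arbitrary: x rule: inc_induct)
  case base
  then show ?case using zero by simp
next
  case (step k)
  let ?S = "{a..b}" and ?Q = "accumulated_coeff b \<Psi>"
  have Suc_diff: "m - k = Suc (m - Suc k)" if "m \<in> {k<..n}" for m using that by auto
  have ev: "\<forall>\<^sub>F u in nhds x. u \<in> ?S \<longrightarrow> ntimes_differentiable_at ?S (m - Suc k) (\<Psi> m) u"
    and diff: "nderiv ?S (m - Suc k) (\<Psi> m) differentiable (at x within ?S)" if "m \<in> {k<..n}" for m
    using step.prems(2)[OF that] by (simp_all add: Suc_diff[OF that])
  \<comment> \<open>This is the left side for \<open>Suc k\<close> with the accumulated coefficient
    unfolded. Its summand \<open>\<Psi> (Suc k)\<close> becomes the term \<open>m = Suc k\<close>,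
    with a derivative of order zero.\<close>
  define F where "F u = (\<Sum>m\<in>{k<..n}. (-1) ^ (m - Suc k) * nderiv ?S (m - Suc k) (\<Psi> m) u) + integral {u..b} (?Q k)" for u
  have insert: "{k<..n} = insert (Suc k) {Suc k<..n}" using step.hyps by auto
  have "\<forall>\<^sub>F u in nhds x. \<forall>m\<in>{k<..n}. u \<in> ?S \<longrightarrow> ntimes_differentiable_at ?S (m - Suc k) (\<Psi> m) u"
    using ev by (intro eventually_ball_finite) auto
  then have F0: "\<forall>\<^sub>F u in nhds x. u \<in> ?S \<longrightarrow> F u = 0"
  proof eventually_elim
    case (elim u)
    show ?case
    proof
      assume u: "u \<in> ?S"
      have "?Q (Suc k) u + (\<Sum>m\<in>{Suc k<..n}. (-1) ^ (m - Suc k) * nderiv ?S (m - Suc k) (\<Psi> m) u) = 0"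
        using elim u by (intro step.IH) auto
      then show "F u = 0" by (simp add: F_def insert)
    qed
  qed
  have Qc: "continuous_on ?S (?Q k)"
    using step.hyps \<Psi> by (intro continuous_on_accumulated_coeff[where n = n]) auto
  have "(F has_vector_derivative
      (\<Sum>m\<in>{k<..n}. (-1) ^ (m - Suc k) * nderiv ?S (Suc (m - Suc k)) (\<Psi> m) x) + - ?Q k x) (at x within ?S)"
    unfolding F_def [abs_def]
  proof (intro has_vector_derivative_add has_vector_derivative_sum integral_has_vector_derivative' Qc step.prems)
    fix m assume "m \<in> {k<..n}"
    from diff[OF this] show "((\<lambda>u. (-1) ^ (m - Suc k) * nderiv ?S (m - Suc k) (\<Psi> m) u) has_vector_derivative
        (-1) ^ (m - Suc k) * nderiv ?S (Suc (m - Suc k)) (\<Psi> m) x) (at x within ?S)"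
      by (simp add: vector_derivative_works has_vector_derivative_mult_right)
  qed
  \<comment> \<open>\<open>F\<close> vanishes near \<open>x\<close> relative to the interval. The
    two derivatives found for \<open>F\<close> then agree, since \<open>x\<close> is a limit point
    of \<open>{a..b}\<close>, also at an end point.\<close>
  moreover have "(F has_vector_derivative 0) (at x within ?S)"
    using F0 step.prems
    by (intro has_vector_derivative_transform_eventually[OF has_vector_derivative_const[of 0]]) (auto elim: eventually_mono)
  ultimately have "(\<Sum>m\<in>{k<..n}. (-1) ^ (m - Suc k) * nderiv ?S (Suc (m - Suc k)) (\<Psi> m) x) + - ?Q k x = 0"
    using at_within_Icc_neq_bot[OF ab step.prems(1)] by (metis vector_derivative_unique_within)
  moreover have "(\<Sum>m\<in>{k<..n}. (-1) ^ (m - k) * nderiv ?S (m - k) (\<Psi> m) x)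
     = - (\<Sum>m\<in>{k<..n}. (-1) ^ (m - Suc k) * nderiv ?S (Suc (m - Suc k)) (\<Psi> m) x)"
    unfolding sum_negf[symmetric] by (intro sum.cong refl, subst (1 2) Suc_diff) auto
  ultimately show ?case by simp
qed

text \<open>Two coefficients serve two purposes: \<open>d = 0\<close> moves the constant
  \<open>1 / Gamma\<close> through the derivative, and \<open>c = d = 1\<close> gives additivity.
  The function \<open>h\<close> is compared with the combination only on the interval.\<close>

lemma ntimes_differentiable_at_linear:
  assumes "a < b" "x \<in> {a..b}"
    "ntimes_differentiable_at {a..b} k f x" "ntimes_differentiable_at {a..b} k g x"
    "\<And>u. u \<in> {a..b} \<Longrightarrow> h u = c * f u + d * g u"
  shows "ntimes_differentiable_at {a..b} k h x \<and>
    nderiv {a..b} k h x = c * nderiv {a..b} k f x + d * nderiv {a..b} k g x"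
  using assms(2-4)
proof (induction k arbitrary: x)
  case 0
  then show ?case by (simp add: assms)
next
  case (Suc k)
  let ?S = "{a..b}"
  have "\<forall>\<^sub>F u in nhds x. u \<in> ?S \<longrightarrow> ntimes_differentiable_at ?S k f u"
    "\<forall>\<^sub>F u in nhds x. u \<in> ?S \<longrightarrow> ntimes_differentiable_at ?S k g u" using Suc.prems by simp_all
  then have ev: "\<forall>\<^sub>F u in nhds x. u \<in> ?S \<longrightarrow> ntimes_differentiable_at ?S k h u \<and>
      c * nderiv ?S k f u + d * nderiv ?S k g u = nderiv ?S k h u"
    by eventually_elim (use Suc.IH in auto)
  have "((\<lambda>u. c * nderiv ?S k f u + d * nderiv ?S k g u) has_vector_derivative
      c * nderiv ?S (Suc k) f x + d * nderiv ?S (Suc k) g x) (at x within ?S)"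
    using Suc.prems
    by (intro has_vector_derivative_add has_vector_derivative_mult_right) (simp_all add: vector_derivative_works)
  then have D: "(nderiv ?S k h has_vector_derivative
      c * nderiv ?S (Suc k) f x + d * nderiv ?S (Suc k) g x) (at x within ?S)"
    by (rule has_vector_derivative_transform_eventually) (use ev Suc.prems in \<open>auto elim: eventually_mono\<close>)
  show ?case
    using ev D vector_derivative_within[OF at_within_Icc_neq_bot[OF assms(1) Suc.prems(1)] D] 
    by (auto elim: eventually_mono intro: differentiableI_vector)
qed

subsection \<open>First variation\<close>

text \<open>Rescaling to the fixed interval \<open>{0..1}\<close> turns the moving upper limit into
  a parameter of the integrand, to which continuity of parameter integrals applies.\<close>

lemma continuous_on_integral_upper_limit_param:
  fixes g :: "real \<Rightarrow> real \<Rightarrow> real"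
  assumes "continuous_on (UNIV \<times> {a..b}) (\<lambda>(\<epsilon>, t). g \<epsilon> t)"
  shows "continuous_on (UNIV \<times> {a..b}) (\<lambda>(\<epsilon>, x). integral {a..x} (g \<epsilon>))"
proof -
  have in_ab: "a + (x - a) * s \<in> {a..x}" if "x \<in> {a..b}" "s \<in> {0..1}" for x s
  proof -
    have "(x - a) * s \<le> x - a" "0 \<le> (x - a) * s"
      using that by (auto intro!: mult_left_le)
    with that show ?thesis unfolding atLeastAtMost_iff by linarith
  qed
  have scale: "integral {a..x} (g \<epsilon>) = integral (cbox 0 1) (\<lambda>s. (x - a) * g \<epsilon> (a + (x - a) * s))"
    if x: "x \<in> {a..b}" for \<epsilon> x
  proof -
    have "continuous_on {a..x} (g \<epsilon>)"
      using x by (intro continuous_on_compose2[OF assms, of _ "\<lambda>t. (\<epsilon>, t)", simplified] continuous_intros) auto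
    then have "((\<lambda>s. (x - a) *\<^sub>R g \<epsilon> (a + (x - a) * s)) has_integral
        (integral {a + (x - a) * 0..a + (x - a) * 1} (g \<epsilon>))) {0..1}"
      using x in_ab[OF x]
      by (intro has_integral_substitution[where c = a and d = x]) (auto intro!: derivative_eq_intros)
    from integral_unique[OF this] show ?thesis by simp
  qed
  have "continuous_on (UNIV \<times> {a..b})
      (\<lambda>p. integral (cbox 0 1) (\<lambda>s. (snd p - a) * g (fst p) (a + (snd p - a) * s)))"
  proof (rule integral_continuous_on_param)
    have "continuous_on ((UNIV \<times> {a..b}) \<times> cbox 0 1)
       (\<lambda>q. (\<lambda>(\<epsilon>, t). g \<epsilon> t) (fst (fst q), a + (snd (fst q) - a) * snd q))"
      using in_ab
      by (intro continuous_on_compose2[OF assms] continuous_intros) fastforce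
    then show "continuous_on ((UNIV \<times> {a..b}) \<times> cbox 0 1)
       (\<lambda>(p, s). (snd p - a) * g (fst p) (a + (snd p - a) * s))"
      unfolding split_beta by (intro continuous_intros) simp
  qed
  then show ?thesis
    by (rule continuous_on_eq) (auto simp: scale)
qed

text \<open>The Leibniz rule is applied twice, first to the inner integral and then to the outer
  one. Here \<open>p\<close> is the curve of arguments, \<open>q\<close> its direction of variation,
  and \<open>j\<close> places the inner integral into the argument of \<open>L\<close>.\<close>

lemma first_variation:
  fixes p q :: "real \<Rightarrow> 'c::euclidean_space" and l :: "'c \<Rightarrow> real" and L :: "'d::euclidean_space \<Rightarrow> real"
    and l' :: "'c \<Rightarrow> 'c \<Rightarrow>\<^sub>L real" and L' :: "'d \<Rightarrow> 'd \<Rightarrow>\<^sub>L real" and j :: "'c \<times> real \<Rightarrow> 'd"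
  assumes "a < b" and j: "bounded_linear j"
    and p: "continuous_on {a..b} p" and q: "continuous_on {a..b} q"
    and inC: "\<And>x \<epsilon>. x \<in> {a..b} \<Longrightarrow> p x + \<epsilon> *\<^sub>R q x \<in> C"
    and inD: "\<And>x \<epsilon> z. x \<in> {a..b} \<Longrightarrow> j (p x + \<epsilon> *\<^sub>R q x, z) \<in> D"
    and l: "\<And>u. u \<in> C \<Longrightarrow> (l has_derivative l' u) (at u within C)" and l'c: "continuous_on C l'"
    and L: "\<And>u. u \<in> D \<Longrightarrow> (L has_derivative L' u) (at u within D)" and L'c: "continuous_on D L'"
    and min: "\<And>\<epsilon>. integral {a..b} (\<lambda>x. L (j (p x, integral {a..x} (\<lambda>t. l (p t)))))
       \<le> integral {a..b} (\<lambda>x. L (j (p x + \<epsilon> *\<^sub>R q x, integral {a..x} (\<lambda>t. l (p t + \<epsilon> *\<^sub>R q t)))))"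
  shows "integral {a..b} (\<lambda>x. L' (j (p x, integral {a..x} (\<lambda>t. l (p t))))
            (j (q x, integral {a..x} (\<lambda>t. l' (p t) (q t))))) = 0"
proof -
  let ?U = "(UNIV :: real set)"
  \<comment> \<open>\<open>f\<close> is differentiable only within \<open>S\<close>, possibly at
    boundary points. The chain rule is applied within the range of \<open>c\<close>, which stays
    inside \<open>S\<close>.\<close>
  have chain: "((\<lambda>\<epsilon>. f (c \<epsilon>)) has_vector_derivative f' (c \<epsilon>) c') (at \<epsilon>)"
    if "\<And>u. u \<in> S \<Longrightarrow> (f has_derivative blinfun_apply (f' u)) (at u within S)" "\<And>\<epsilon>. c \<epsilon> \<in> S"
      "(c has_vector_derivative c') (at \<epsilon>)"
    for f :: "'e::euclidean_space \<Rightarrow> real" and f' :: "'e \<Rightarrow> 'e \<Rightarrow>\<^sub>L real" and c c' S \<epsilon>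
  proof -
    have "(f has_derivative blinfun_apply (f' (c \<epsilon>))) (at (c \<epsilon>) within range c)"
      using that(1,2) by (blast intro: has_derivative_subset)
    from vector_derivative_diff_chain_within[OF that(3) this] show ?thesis by (simp add: comp_def)
  qed
  have lc: "continuous_on C l" and Lc: "continuous_on D L"
    by (rule has_derivative_continuous_on, rule l L, assumption)+
  have p2: "continuous_on (?U \<times> {a..b}) (\<lambda>(\<epsilon>, t). p t + \<epsilon> *\<^sub>R q t)"
    unfolding split_beta
    by (intro continuous_intros continuous_on_compose2[OF p] continuous_on_compose2[OF q]) auto
  have q2: "continuous_on (?U \<times> {a..b}) (\<lambda>(\<epsilon>, t). q t)"
    unfolding split_beta by (intro continuous_intros continuous_on_compose2[OF q]) auto
  define g where "g \<epsilon> t = l (p t + \<epsilon> *\<^sub>R q t)" for \<epsilon> t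
  define g' where "g' \<epsilon> t = l' (p t + \<epsilon> *\<^sub>R q t) (q t)" for \<epsilon> t
  have gc: "continuous_on (?U \<times> {a..b}) (\<lambda>(\<epsilon>, t). g \<epsilon> t)"
    unfolding g_def split_beta
    using p2 inC by (intro continuous_on_compose2[OF lc]) (auto simp: split_beta)
  have g'c: "continuous_on (?U \<times> {a..b}) (\<lambda>(\<epsilon>, t). g' \<epsilon> t)"
    unfolding g'_def split_beta
    using p2 q2 inC by (intro bounded_bilinear.continuous_on[OF bounded_bilinear_blinfun_apply]
        continuous_on_compose2[OF l'c]) (auto simp: split_beta)
  define Z where "Z \<epsilon> x = integral {a..x} (g \<epsilon>)" for \<epsilon> x
  define Z' where "Z' \<epsilon> x = integral {a..x} (g' \<epsilon>)" for \<epsilon> x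
  have Zc: "continuous_on (?U \<times> {a..b}) (\<lambda>(\<epsilon>, x). Z \<epsilon> x)"
    unfolding Z_def by (rule continuous_on_integral_upper_limit_param[OF gc])
  have Z'c: "continuous_on (?U \<times> {a..b}) (\<lambda>(\<epsilon>, x). Z' \<epsilon> x)"
    unfolding Z'_def by (rule continuous_on_integral_upper_limit_param[OF g'c])
  have g_deriv: "((\<lambda>\<epsilon>. g \<epsilon> t) has_vector_derivative g' \<epsilon> t) (at \<epsilon>)" if "t \<in> {a..b}" for \<epsilon> t
    unfolding g_def g'_def using that inC
    by (intro chain[OF l]) (auto intro!: derivative_eq_intros)
  have Z_deriv: "((\<lambda>\<epsilon>. Z \<epsilon> x) has_vector_derivative Z' \<epsilon> x) (at \<epsilon>)" if x: "x \<in> {a..b}" for \<epsilon> x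
    unfolding Z_def Z'_def box_real[symmetric]
  proof (rule leibniz_rule_vector_derivative[of UNIV])
    show "((\<lambda>\<epsilon>. g \<epsilon> t) has_vector_derivative g' \<epsilon> t) (at \<epsilon>)" if "t \<in> cbox a x" for \<epsilon> t
      using x that by (intro g_deriv) auto
    show "g \<epsilon> integrable_on cbox a x" for \<epsilon>
      using x unfolding box_real
      by (intro integrable_continuous_real continuous_on_compose2[OF gc, of _ "\<lambda>t. (\<epsilon>, t)", simplified] continuous_intros) auto
    show "continuous_on (UNIV \<times> cbox a x) (\<lambda>(\<epsilon>, t). g' \<epsilon> t)"
      using x by (intro continuous_on_subset[OF g'c]) auto
  qed auto
  define c where "c \<epsilon> x = j (p x + \<epsilon> *\<^sub>R q x, Z \<epsilon> x)" for \<epsilon> x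
  define c' where "c' \<epsilon> x = j (q x, Z' \<epsilon> x)" for \<epsilon> x
  have cc: "continuous_on (?U \<times> {a..b}) (\<lambda>(\<epsilon>, x). c \<epsilon> x)"
    unfolding c_def split_beta
    using p2 Zc by (intro bounded_linear.continuous_on[OF j] continuous_on_Pair) (auto simp: split_beta)
  have c'c: "continuous_on (?U \<times> {a..b}) (\<lambda>(\<epsilon>, x). c' \<epsilon> x)"
    unfolding c'_def split_beta
    using q2 Z'c by (intro bounded_linear.continuous_on[OF j] continuous_on_Pair) (auto simp: split_beta)
  have c_deriv: "((\<lambda>\<epsilon>. c \<epsilon> x) has_vector_derivative c' \<epsilon> x) (at \<epsilon>)" if "x \<in> {a..b}" for \<epsilon> x
    unfolding c_def c'_def
    by (intro bounded_linear.has_vector_derivative[OF j] has_vector_derivative_Pair Z_deriv that)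
       (auto intro!: derivative_eq_intros)
  define J where "J \<epsilon> = integral (cbox a b) (\<lambda>x. L (c \<epsilon> x))" for \<epsilon>
  \<comment> \<open>The outer Leibniz rule asks for joint continuity in \<open>\<epsilon>\<close>
    and \<open>x\<close>. This is why \<open>Z\<close> and \<open>Z'\<close> were shown continuous
    as functions of both.\<close>
  have "(J has_vector_derivative integral (cbox a b) (\<lambda>x. L' (c 0 x) (c' 0 x))) (at 0)"
    unfolding J_def [abs_def]
  proof (rule leibniz_rule_vector_derivative[of UNIV])
    show "((\<lambda>\<epsilon>. L (c \<epsilon> x)) has_vector_derivative L' (c \<epsilon> x) (c' \<epsilon> x)) (at \<epsilon>)" if "x \<in> cbox a b" for \<epsilon> x
      using that inD by (intro chain[OF L] c_deriv) (auto simp: c_def)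
    show "(\<lambda>x. L (c \<epsilon> x)) integrable_on cbox a b" for \<epsilon>
      using inD unfolding box_real
      by (intro integrable_continuous_real continuous_on_compose2[OF Lc]
        continuous_on_compose2[OF cc, of _ "\<lambda>t. (\<epsilon>, t)", simplified] continuous_intros) (auto simp: c_def)
    show "continuous_on (UNIV \<times> cbox a b) (\<lambda>(\<epsilon>, x). L' (c \<epsilon> x) (c' \<epsilon> x))"
      unfolding split_beta using cc c'c inD
      by (intro bounded_bilinear.continuous_on[OF bounded_bilinear_blinfun_apply]
        continuous_on_compose2[OF L'c]) (auto simp: split_beta c_def)
  qed auto
  then have "DERIV J 0 :> integral {a..b} (\<lambda>x. L' (c 0 x) (c' 0 x))"
    by (simp add: has_real_derivative_iff_has_vector_derivative)
  moreover have "J 0 \<le> J \<epsilon>" for \<epsilon>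
    using min[of \<epsilon>] by (simp add: J_def c_def Z_def g_def [abs_def])
  \<comment> \<open>Minimality holds for every \<open>\<epsilon>\<close>, so the radius
    \<open>1\<close> is an arbitrary choice.\<close>
  ultimately have "integral {a..b} (\<lambda>x. L' (c 0 x) (c' 0 x)) = 0"
    by (intro DERIV_local_min[of J _ 0 1]) auto
  then show ?thesis by (simp add: c_def c'_def Z_def Z'_def g_def [abs_def] g'_def [abs_def])
qed

text \<open>A direction with zero first component never leaves \<open>A \<times> UNIV\<close>, so
  the two-sided \<open>deriv\<close> along it is governed by the derivative within that set, even
  when the first coordinate of \<open>p\<close> is an end point of \<open>A\<close>.\<close>

lemma partial_deriv_eq:
  fixes f :: "real \<times> 'c::euclidean_space \<Rightarrow> real"
  assumes "(f has_derivative f') (at p within A \<times> UNIV)" "fst u = 0" "p \<in> A \<times> UNIV"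
  shows "partial_deriv u f p = f' u"
proof -
  have "((\<lambda>s. p + s *\<^sub>R u) has_vector_derivative u) (at 0)"
    by (auto intro!: derivative_eq_intros)
  moreover have "(f has_derivative f') (at (p + 0 *\<^sub>R u) within range (\<lambda>s. p + s *\<^sub>R u))"
  proof -
    have "p + s *\<^sub>R u \<in> A \<times> UNIV" for s
      using assms(2,3) by (cases p, cases u) auto
    then show ?thesis using assms(1) by (auto intro: has_derivative_subset)
  qed
  ultimately have "((\<lambda>s. f (p + s *\<^sub>R u)) has_vector_derivative f' u) (at 0)"
    using vector_derivative_diff_chain_within[of "\<lambda>s. p + s *\<^sub>R u" u 0 UNIV f f'] by (simp add: comp_def)
  then show ?thesis
    unfolding partial_deriv_def
    by (intro DERIV_imp_deriv) (simp add: has_real_derivative_iff_has_vector_derivative)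
qed

subsection \<open>Admissible variations\<close>

text \<open>Encodes a test function \<open>H 0\<close> of class \<open>C^n\<close> together with its
  derivatives. Carrying them as a sequence lets them be built by repeated integration.\<close>

definition derivative_chain :: "real \<Rightarrow> real \<Rightarrow> nat \<Rightarrow> (nat \<Rightarrow> real \<Rightarrow> real) \<Rightarrow> bool" where
  "derivative_chain a b n H \<longleftrightarrow> (\<forall>k\<le>n. continuous_on {a..b} (H k)) \<and>
     (\<forall>k<n. \<forall>x\<in>{a..b}. (H k has_vector_derivative H (Suc k) x) (at x within {a..b}))"

text \<open>The differentiation step shared by the formula for derivatives of a perturbed function
  and by the proof that they exist.\<close>

lemma has_vector_derivative_nderiv_add_scaled_chain:
  assumes H: "derivative_chain a b n H" and "k < n" "x \<in> {a..b}"
    and "\<And>u. u \<in> {a..b} \<Longrightarrow> nderiv {a..b} k (\<lambda>t. y t + \<epsilon> * H 0 t) u = nderiv {a..b} k y u + \<epsilon> * H k u"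
    and "nderiv {a..b} k y differentiable (at x within {a..b})"
  shows "(nderiv {a..b} k (\<lambda>t. y t + \<epsilon> * H 0 t) has_vector_derivative
      nderiv {a..b} (Suc k) y x + \<epsilon> * H (Suc k) x) (at x within {a..b})"
proof (rule has_vector_derivative_transform[OF assms(3,4)])
  show "((\<lambda>u. nderiv {a..b} k y u + \<epsilon> * H k u) has_vector_derivative
      nderiv {a..b} (Suc k) y x + \<epsilon> * H (Suc k) x) (at x within {a..b})"
    using assms
    by (intro has_vector_derivative_add has_vector_derivative_mult_right)
       (auto simp: vector_derivative_works derivative_chain_def)
qed

text \<open>The last differentiation is assumed possible only at \<open>x\<close>: for
  \<open>y \<in> AC n a b\<close> the derivative of order \<open>n\<close> is available only almost
  everywhere, whereas those of lower order exist throughout.\<close>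

lemma nderiv_add_scaled_chain:
  assumes "a < b" and H: "derivative_chain a b n H" and "k \<le> n" "x \<in> {a..b}"
    and "\<And>i u. Suc i < k \<Longrightarrow> u \<in> {a..b} \<Longrightarrow> nderiv {a..b} i y differentiable (at u within {a..b})"
    and "\<And>i. Suc i = k \<Longrightarrow> nderiv {a..b} i y differentiable (at x within {a..b})"
  shows "nderiv {a..b} k (\<lambda>t. y t + \<epsilon> * H 0 t) x = nderiv {a..b} k y x + \<epsilon> * H k x"
  using assms(3-6)
proof (induction k arbitrary: x)
  case (Suc k)
  have "(nderiv {a..b} k (\<lambda>t. y t + \<epsilon> * H 0 t) has_vector_derivative
      nderiv {a..b} (Suc k) y x + \<epsilon> * H (Suc k) x) (at x within {a..b})"
    using Suc.prems by (intro has_vector_derivative_nderiv_add_scaled_chain[OF H] Suc.IH) auto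
  from vector_derivative_within[OF at_within_Icc_neq_bot[OF assms(1) Suc.prems(2)] this]
  show ?case by simp
qed simp

lemma nderiv_add_scaled_chain_differentiable:
  assumes "a < b" and H: "derivative_chain a b n H" and "k < n" "x \<in> {a..b}"
    and "\<And>i u. i < k \<Longrightarrow> u \<in> {a..b} \<Longrightarrow> nderiv {a..b} i y differentiable (at u within {a..b})"
    and "nderiv {a..b} k y differentiable (at x within {a..b})"
  shows "nderiv {a..b} k (\<lambda>t. y t + \<epsilon> * H 0 t) differentiable (at x within {a..b})"
  using assms
  by (intro differentiableI_vector[OF has_vector_derivative_nderiv_add_scaled_chain[OF H]]
      nderiv_add_scaled_chain[OF assms(1) H]) auto

lemma abs_continuous_on_interval_add_lipschitz:
  assumes f: "abs_continuous_on_interval a b f"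
    and g: "\<And>u v. u \<in> {a..b} \<Longrightarrow> v \<in> {a..b} \<Longrightarrow> \<bar>g u - g v\<bar> \<le> M * \<bar>u - v\<bar>"
    and h: "\<And>u. u \<in> {a..b} \<Longrightarrow> h u = f u + g u"
  shows "abs_continuous_on_interval a b h"
  unfolding abs_continuous_on_interval_def
proof (intro allI impI)
  fix e :: real assume e: "e > 0"
  then obtain d where d: "d > 0" and fd: "\<And>D T. D division_of T \<and> T \<subseteq> {a..b} \<and> (\<Sum>K\<in>D. Sup K - Inf K) < d \<Longrightarrow>
      (\<Sum>K\<in>D. \<bar>f (Sup K) - f (Inf K)\<bar>) < e / 2"
    using f unfolding abs_continuous_on_interval_def by (meson half_gt_zero)
  \<comment> \<open>The tolerance is shared equally between \<open>f\<close> and the Lipschitz part.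
    The sign of \<open>M\<close> is unrestricted, and \<open>\<bar>M\<bar> + 1\<close> keeps the
    denominator positive.\<close>
  define d' where "d' = min d (e / (2 * (\<bar>M\<bar> + 1)))"
  have "d' > 0" using d e by (auto simp: d'_def)
  moreover have "(\<Sum>K\<in>D. \<bar>h (Sup K) - h (Inf K)\<bar>) < e"
    if D: "D division_of T \<and> T \<subseteq> {a..b} \<and> (\<Sum>K\<in>D. Sup K - Inf K) < d'" for D T
  proof -
    have K: "Sup K \<in> {a..b}" "Inf K \<in> {a..b}" "Inf K \<le> Sup K" if KD: "K \<in> D" for K
    proof -
      obtain c e where ce: "K = cbox c e" "K \<noteq> {}" "K \<subseteq> {a..b}"
        using division_ofD(2-4)[of D T K] D KD by (metis subset_trans)
      then have "Sup K = e" "Inf K = c" "c \<le> e" by auto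
      with ce show "Sup K \<in> {a..b}" "Inf K \<in> {a..b}" "Inf K \<le> Sup K" by auto
    qed
    have "(\<Sum>K\<in>D. \<bar>h (Sup K) - h (Inf K)\<bar>) \<le> (\<Sum>K\<in>D. \<bar>f (Sup K) - f (Inf K)\<bar> + \<bar>M\<bar> * (Sup K - Inf K))"
    proof (rule sum_mono)
      fix K assume KD: "K \<in> D"
      have "\<bar>g (Sup K) - g (Inf K)\<bar> \<le> M * (Sup K - Inf K)" using g[of "Sup K" "Inf K"] K[OF KD] by auto
      also have "\<dots> \<le> \<bar>M\<bar> * (Sup K - Inf K)" using K[OF KD] by (intro mult_right_mono) auto
      finally show "\<bar>h (Sup K) - h (Inf K)\<bar> \<le> \<bar>f (Sup K) - f (Inf K)\<bar> + \<bar>M\<bar> * (Sup K - Inf K)"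
        using K[OF KD] h by auto
    qed
    also have "\<dots> = (\<Sum>K\<in>D. \<bar>f (Sup K) - f (Inf K)\<bar>) + \<bar>M\<bar> * (\<Sum>K\<in>D. Sup K - Inf K)"
      by (simp add: sum.distrib sum_distrib_left)
    also have "\<dots> < e / 2 + e / 2"
    proof (rule add_less_le_mono)
      show "(\<Sum>K\<in>D. \<bar>f (Sup K) - f (Inf K)\<bar>) < e / 2"
        using D by (intro fd[of D T]) (auto simp: d'_def)
      have "\<bar>M\<bar> * (\<Sum>K\<in>D. Sup K - Inf K) \<le> (\<bar>M\<bar> + 1) * (e / (2 * (\<bar>M\<bar> + 1)))"
        using D K by (intro mult_mono sum_nonneg) (auto simp: d'_def)
      also have "(\<bar>M\<bar> + 1) * (e / (2 * (\<bar>M\<bar> + 1))) = e / 2"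
        using abs_ge_zero[of M] by (simp add: divide_simps)
      finally show "\<bar>M\<bar> * (\<Sum>K\<in>D. Sup K - Inf K) \<le> e / 2" .
    qed
    finally show ?thesis by simp
  qed
  ultimately show "\<exists>d>0. \<forall>D T. D division_of T \<and> T \<subseteq> {a..b} \<and> (\<Sum>K\<in>D. Sup K - Inf K) < d \<longrightarrow>
      (\<Sum>K\<in>D. \<bar>h (Sup K) - h (Inf K)\<bar>) < e" by blast
qed

lemma AC_add_scaled_chain:
  assumes "a < b" and y: "y \<in> AC n a b" and "n \<ge> 1" and H: "derivative_chain a b n H"
  shows "(\<lambda>t. y t + \<epsilon> * H 0 t) \<in> AC n a b"
proof -
  let ?S = "{a..b}" and ?y = "\<lambda>t. y t + \<epsilon> * H 0 t"
  have yd: "nderiv ?S j y differentiable (at x within ?S)" if "Suc j < n" "x \<in> ?S" for j x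
    using y that by (auto simp: AC_def)
  have yc: "continuous_on ?S (nderiv ?S j y)" if "j < n" for j using y that by (auto simp: AC_def)
  have yac: "abs_continuous_on_interval a b (nderiv ?S (n - 1) y)" using y by (auto simp: AC_def)
  have Hc: "continuous_on ?S (H j)" if "j \<le> n" for j using H that by (auto simp: derivative_chain_def)
  have eq: "nderiv ?S j ?y x = nderiv ?S j y x + \<epsilon> * H j x" if "j < n" "x \<in> ?S" for j x
    using that assms yd by (intro nderiv_add_scaled_chain[where n = n]) auto
  have "nderiv ?S j ?y differentiable (at x within ?S)" if "Suc j < n" "x \<in> ?S" for j x
    using that assms yd by (intro nderiv_add_scaled_chain_differentiable[where n = n]) auto
  moreover have "continuous_on ?S (nderiv ?S j ?y)" if "j < n" for j
    by (rule continuous_on_eq[of _ "\<lambda>x. nderiv ?S j y x + \<epsilon> * H j x"])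
       (use that in \<open>auto intro!: continuous_intros yc Hc simp: eq\<close>)
  moreover have "abs_continuous_on_interval a b (nderiv ?S (n - 1) ?y)"
  proof -
    obtain M where "\<forall>u\<in>H n ` ?S. norm u \<le> M"
      using compact_imp_bounded[OF compact_continuous_image[OF Hc[OF order_refl] compact_Icc]]
      unfolding bounded_iff by blast
    then have M: "norm (H n x) \<le> M" if "x \<in> ?S" for x using that by auto
    \<comment> \<open>The bound on \<open>H n\<close> and the mean value inequality make
      \<open>H (n - 1)\<close> Lipschitz, which preserves absolute continuity of the top
      derivative.\<close>
    have "\<bar>\<epsilon> * H (n - 1) u - \<epsilon> * H (n - 1) v\<bar> \<le> (\<bar>\<epsilon>\<bar> * M) * \<bar>u - v\<bar>" if "u \<in> ?S" "v \<in> ?S" for u v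
    proof -
      have "norm (H (n - 1) u - H (n - 1) v) \<le> M * norm (u - v)"
      proof (rule field_differentiable_bound)
        show "(H (n - 1) has_field_derivative H n x) (at x within ?S)" if "x \<in> ?S" for x
          using H that \<open>n \<ge> 1\<close> unfolding derivative_chain_def has_real_derivative_iff_has_vector_derivative
          by (cases n) auto
      qed (use that M in auto)
      then have "\<bar>\<epsilon>\<bar> * \<bar>H (n - 1) u - H (n - 1) v\<bar> \<le> \<bar>\<epsilon>\<bar> * (M * \<bar>u - v\<bar>)"
        by (intro mult_left_mono) auto
      then show ?thesis by (simp add: abs_mult mult.assoc flip: right_diff_distrib)
    qed
    with yac show ?thesis
      by (rule abs_continuous_on_interval_add_lipschitz) (use eq \<open>n \<ge> 1\<close> in auto)
  qed
  ultimately show ?thesis by (auto simp: AC_def)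
qed

lemma nat_ceiling_eq:
  assumes "\<gamma> \<in> {real k - 1<..<real k}" "k \<ge> 1"
  shows "nat \<lceil>\<gamma>\<rceil> = k"
proof -
  have "\<lceil>\<gamma>\<rceil> = int k" using assms by (intro ceiling_unique) auto
  then show ?thesis by simp
qed

text \<open>The identity for \<open>h\<close> may fail on a null set, as it can for top derivatives
  of absolutely continuous functions. Passing to \<open>integral\<close>, the exceptional set is
  discarded as negligible.\<close>

lemma absolutely_integrable_add_scaled_AE:
  fixes f g h w :: "real \<Rightarrow> real"
  assumes f: "(\<lambda>t. w t * f t) absolutely_integrable_on {a..x}"
    and g: "(\<lambda>t. w t * g t) absolutely_integrable_on {a..x}"
    and ae: "AE t in lebesgue. t \<in> {a..x} \<longrightarrow> h t = f t + \<epsilon> * g t"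
  shows "(\<lambda>t. w t * h t) absolutely_integrable_on {a..x}"
    and "(LINT t:{a..x}|lebesgue. w t * h t)
       = (LINT t:{a..x}|lebesgue. w t * f t) + \<epsilon> * (LINT t:{a..x}|lebesgue. w t * g t)"
proof -
  obtain N where N: "negligible N" "{t. \<not> (t \<in> {a..x} \<longrightarrow> h t = f t + \<epsilon> * g t)} \<subseteq> N"
    using ae unfolding eventually_ae_filter negligible_iff_null_sets by auto
  have eq: "w t * h t = w t * f t + \<epsilon> * (w t * g t)" if "t \<in> {a..x} - N" for t
    using that N(2) by (auto simp: algebra_simps)
  have fg: "(\<lambda>t. w t * f t + \<epsilon> * (w t * g t)) absolutely_integrable_on {a..x}"
    using f g by (intro set_integral_add set_integrable_mult_right) auto
  then show 1: "(\<lambda>t. w t * h t) absolutely_integrable_on {a..x}"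
    by (rule absolutely_integrable_spike[OF _ N(1)]) (rule eq)
  have "(LINT t:{a..x}|lebesgue. w t * h t) = integral {a..x} (\<lambda>t. w t * h t)"
    by (rule set_lebesgue_integral_eq_integral(2)[OF 1])
  also have "\<dots> = integral {a..x} (\<lambda>t. w t * f t + \<epsilon> * (w t * g t))"
    by (rule integral_spike[OF N(1)]) (use eq in auto)
  also have "\<dots> = (LINT t:{a..x}|lebesgue. w t * f t + \<epsilon> * (w t * g t))"
    by (rule set_lebesgue_integral_eq_integral(2)[OF fg, symmetric])
  finally show "(LINT t:{a..x}|lebesgue. w t * h t)
       = (LINT t:{a..x}|lebesgue. w t * f t) + \<epsilon> * (LINT t:{a..x}|lebesgue. w t * g t)"
    using f g by (simp add: set_integral_add)
qed

lemma rl_left_int_add_scaled: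
  assumes "a < b" "x \<in> {a..b}" "\<beta> > 0" "rl_left_int_exists a \<beta> y x" "continuous_on {a..b} h"
  shows "rl_left_int_exists a \<beta> (\<lambda>t. y t + \<epsilon> * h t) x"
    and "rl_left_int a \<beta> (\<lambda>t. y t + \<epsilon> * h t) x = rl_left_int a \<beta> y x + \<epsilon> * rl_left_int a \<beta> h x"
  using absolutely_integrable_add_scaled_AE[where w = "\<lambda>t. (x - t) powr (\<beta> - 1)" and f = y and g = h and a = a
      and x = x and \<epsilon> = \<epsilon> and h = "\<lambda>t. y t + \<epsilon> * h t"] assms
    rl_left_int_exists_continuous[of a b h \<beta> x]
  by (auto simp: rl_left_int_exists_def rl_left_int_def algebra_simps)

lemma caputo_eq_rl_left_int:
  assumes "\<gamma> \<in> {real k - 1<..<real k}" "k \<ge> 1"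
  shows "caputo a b \<gamma> f = rl_left_int a (real k - \<gamma>) (nderiv {a..b} k f)"
  by (simp add: caputo_def [abs_def] rl_left_int_def [abs_def] nat_ceiling_eq[OF assms])

text \<open>The derivative formula is used at the points where the derivative of \<open>y\<close> of
  order \<open>k - 1\<close> is differentiable, hence almost everywhere. The contribution of the
  test function is the fractional integral of the continuous \<open>H k\<close>.\<close>

lemma caputo_add_scaled_chain:
  assumes "a < b" and x: "x \<in> {a..b}" and \<gamma>: "\<gamma> \<in> {real k - 1<..<real k}" "k \<in> {1..n}"
    and y: "y \<in> AC n a b" "caputo_exists a b \<gamma> y x" and H: "derivative_chain a b n H"
  shows "caputo_exists a b \<gamma> (\<lambda>t. y t + \<epsilon> * H 0 t) x"
    and "caputo a b \<gamma> (\<lambda>t. y t + \<epsilon> * H 0 t) x = caputo a b \<gamma> y x + \<epsilon> * rl_left_int a (real k - \<gamma>) (H k) x"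
proof -
  let ?S = "{a..b}" and ?y = "\<lambda>t. y t + \<epsilon> * H 0 t"
  have k: "k \<ge> 1" using \<gamma> by auto
  note ceil = nat_ceiling_eq[OF \<gamma>(1) k]
  have yd: "nderiv ?S j y differentiable (at x within ?S)" if "Suc j < n" "x \<in> ?S" for j x
    using y that by (auto simp: AC_def)
  have ae: "AE t in lebesgue. t \<in> {a..x} \<longrightarrow> nderiv ?S (k - 1) y differentiable (at t within ?S)"
    and int: "(\<lambda>t. (x - t) powr (real k - \<gamma> - 1) * nderiv ?S k y t) absolutely_integrable_on {a..x}"
    using y(2) by (simp_all add: caputo_exists_def ceil)
  have Hc: "continuous_on ?S (H k)" using H \<gamma> by (auto simp: derivative_chain_def)
  have Hint: "(\<lambda>t. (x - t) powr (real k - \<gamma> - 1) * H k t) absolutely_integrable_on {a..x}"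
    using rl_left_int_exists_continuous[OF Hc _ x, of "real k - \<gamma>"] \<gamma> by (simp add: rl_left_int_exists_def)
  have ae': "AE t in lebesgue. t \<in> {a..x} \<longrightarrow> nderiv ?S k ?y t = nderiv ?S k y t + \<epsilon> * H k t"
    using ae
  proof eventually_elim
    case (elim t)
    show ?case
    proof
      assume t: "t \<in> {a..x}"
      with elim x have "nderiv ?S (k - 1) y differentiable (at t within ?S)" by auto
      then show "nderiv ?S k ?y t = nderiv ?S k y t + \<epsilon> * H k t"
        using t x \<gamma> yd by (intro nderiv_add_scaled_chain[OF assms(1) H]) auto
    qed
  qed
  have "AE t in lebesgue. t \<in> {a..x} \<longrightarrow> nderiv ?S (k - 1) ?y differentiable (at t within ?S)"
    using ae
  proof eventually_elim
    case (elim t)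
    then show ?case using x \<gamma> yd
      by (intro impI nderiv_add_scaled_chain_differentiable[OF assms(1) H]) auto
  qed
  with absolutely_integrable_add_scaled_AE(1)[OF int Hint ae']
  show "caputo_exists a b \<gamma> ?y x" by (simp add: caputo_exists_def ceil)
  show "caputo a b \<gamma> ?y x = caputo a b \<gamma> y x + \<epsilon> * rl_left_int a (real k - \<gamma>) (H k) x"
    using absolutely_integrable_add_scaled_AE(2)[OF int Hint ae']
    by (simp add: caputo_eq_rl_left_int[OF \<gamma>(1) k] rl_left_int_def algebra_simps)
qed

lemma F_class_add_scaled_chain:
  assumes "a < b" "n \<ge> 1" "\<beta> > 0" and \<alpha>: "\<And>k. k \<in> {1..n} \<Longrightarrow> \<alpha> k \<in> {real k - 1<..<real k}"
    and y: "y \<in> F_class n a b \<alpha> \<beta>" and H: "derivative_chain a b n H"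
  shows "(\<lambda>t. y t + \<epsilon> * H 0 t) \<in> F_class n a b \<alpha> \<beta>"
proof -
  let ?y = "\<lambda>t. y t + \<epsilon> * H 0 t"
  have AC: "y \<in> AC n a b" using y by (simp add: F_class_def)
  have Hc: "continuous_on {a..b} (H k)" if "k \<le> n" for k using H that by (auto simp: derivative_chain_def)
  have cap: "caputo_exists a b (\<alpha> k) ?y x"
    "caputo a b (\<alpha> k) ?y x = caputo a b (\<alpha> k) y x + \<epsilon> * rl_left_int a (real k - \<alpha> k) (H k) x"
    if "k \<in> {1..n}" "x \<in> {a..b}" for k x
    using y caputo_add_scaled_chain[OF assms(1) that(2) \<alpha>[OF that(1)] that(1) AC _ H, of \<epsilon>] that
    by (auto simp: F_class_def)
  have rl: "rl_left_int_exists a \<beta> ?y x"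
    "rl_left_int a \<beta> ?y x = rl_left_int a \<beta> y x + \<epsilon> * rl_left_int a \<beta> (H 0) x" if "x \<in> {a..b}" for x
    using y rl_left_int_add_scaled[OF assms(1) that assms(3), of y "H 0" \<epsilon>] that Hc
    by (auto simp: F_class_def)
  have "continuous_on {a..b} (caputo a b (\<alpha> k) ?y)" if k: "k \<in> {1..n}" for k
    by (rule continuous_on_eq[of _ "\<lambda>x. caputo a b (\<alpha> k) y x + \<epsilon> * rl_left_int a (real k - \<alpha> k) (H k) x"])
       (use y k \<alpha>[OF k] in \<open>auto simp: cap F_class_def intro!: continuous_intros continuous_on_rl_left_int Hc\<close>)
  moreover have "continuous_on {a..b} (rl_left_int a \<beta> ?y)"
    by (rule continuous_on_eq[of _ "\<lambda>x. rl_left_int a \<beta> y x + \<epsilon> * rl_left_int a \<beta> (H 0) x"])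
       (use y assms(3) in \<open>auto simp: rl F_class_def intro!: continuous_intros continuous_on_rl_left_int Hc\<close>)
  ultimately show ?thesis
    using cap(1) rl(1) AC_add_scaled_chain[OF assms(1) AC assms(2) H] by (auto simp: F_class_def)
qed

subsection \<open>Stationarity for fractional variations\<close>

text \<open>Moves the constant \<open>1 / Gamma (real k - \<gamma>)\<close> under the derivative, so
  that the right derivative becomes an ordinary derivative of a right fractional integral.\<close>

lemma rl_right_deriv_eq_nderiv:
  assumes "a < b" "x \<in> {a..b}" and \<gamma>: "\<gamma> \<in> {real k - 1<..<real k}" "k \<ge> 1"
    and ex: "rl_right_deriv_exists a b \<gamma> f x"
  shows "ntimes_differentiable_at {a..b} k (rl_right_int b (real k - \<gamma>) f) x"
    and "rl_right_deriv a b \<gamma> f x = (-1) ^ k * nderiv {a..b} k (rl_right_int b (real k - \<gamma>) f) x"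
proof -
  let ?F = "\<lambda>u. LINT t:{u..b}|lebesgue. (t - u) powr (real k - \<gamma> - 1) * f t"
  have ge: "\<not> \<gamma> < 0" using \<gamma> by auto
  have "ntimes_differentiable_at {a..b} k ?F x"
    using ex by (simp add: rl_right_deriv_exists_def ge nat_ceiling_eq[OF \<gamma>])
  then have lin: "ntimes_differentiable_at {a..b} k (rl_right_int b (real k - \<gamma>) f) x \<and>
      nderiv {a..b} k (rl_right_int b (real k - \<gamma>) f) x
      = 1 / Gamma (real k - \<gamma>) * nderiv {a..b} k ?F x + 0 * nderiv {a..b} k ?F x"
    by (intro ntimes_differentiable_at_linear assms(1,2)) (simp_all add: rl_right_int_def)
  then show "ntimes_differentiable_at {a..b} k (rl_right_int b (real k - \<gamma>) f) x" by simp
  from lin show "rl_right_deriv a b \<gamma> f x = (-1) ^ k * nderiv {a..b} k (rl_right_int b (real k - \<gamma>) f) x"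
    by (simp add: rl_right_deriv_def ge nat_ceiling_eq[OF \<gamma>])
qed

lemma LINT_powr_shift_add:
  fixes f g :: "real \<Rightarrow> real"
  assumes "continuous_on {a..b} f" "continuous_on {a..b} g" "\<gamma> > 0" "x \<in> {a..b}"
  shows "(LINT t:{x..b}|lebesgue. (t - x) powr (\<gamma> - 1) * (f t + g t))
     = (LINT t:{x..b}|lebesgue. (t - x) powr (\<gamma> - 1) * f t)
       + (LINT t:{x..b}|lebesgue. (t - x) powr (\<gamma> - 1) * g t)"
  unfolding distrib_left using assms
  by (intro set_integral_add absolutely_integrable_powr_shift_mult) (auto intro: continuous_on_subset)

lemma rl_right_int_add:
  assumes "continuous_on {a..b} f" "continuous_on {a..b} g" "\<gamma> > 0" "x \<in> {a..b}"
  shows "rl_right_int b \<gamma> (\<lambda>t. f t + g t) x = rl_right_int b \<gamma> f x + rl_right_int b \<gamma> g x"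
  using LINT_powr_shift_add[OF assms] by (simp add: rl_right_int_def add_divide_distrib)

text \<open>Connects the stationarity condition, stated for a combined coefficient, with an equation
  that lists the contributions of \<open>L\<close> and \<open>l\<close> separately.\<close>

lemma rl_right_deriv_add:
  assumes "a < b" and x: "x \<in> {a..b}" and \<gamma>: "\<gamma> \<in> {real k - 1<..<real k}" "k \<ge> 1"
    and f: "continuous_on {a..b} f" and g: "continuous_on {a..b} g"
    and ex: "rl_right_deriv_exists a b \<gamma> f x" "rl_right_deriv_exists a b \<gamma> g x"
  shows "rl_right_deriv_exists a b \<gamma> (\<lambda>t. f t + g t) x"
    and "rl_right_deriv a b \<gamma> (\<lambda>t. f t + g t) x = rl_right_deriv a b \<gamma> f x + rl_right_deriv a b \<gamma> g x"
proof -
  let ?F = "\<lambda>f u. LINT t:{u..b}|lebesgue. (t - u) powr (real k - \<gamma> - 1) * f t"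
  have ge: "\<not> \<gamma> < 0" using \<gamma> by auto
  have pos: "real k - \<gamma> > 0" using \<gamma> by auto
  have "ntimes_differentiable_at {a..b} k (?F f) x" "ntimes_differentiable_at {a..b} k (?F g) x"
    using ex by (simp_all add: rl_right_deriv_exists_def ge nat_ceiling_eq[OF \<gamma>])
  then have lin: "ntimes_differentiable_at {a..b} k (?F (\<lambda>t. f t + g t)) x \<and>
      nderiv {a..b} k (?F (\<lambda>t. f t + g t)) x = 1 * nderiv {a..b} k (?F f) x + 1 * nderiv {a..b} k (?F g) x"
    using LINT_powr_shift_add[OF f g pos]
    by (intro ntimes_differentiable_at_linear assms(1,2)) simp_all
  have "continuous_on {a..b} (\<lambda>t. f t + g t)" by (intro continuous_intros f g)
  then have "rl_right_int_exists b (real k - \<gamma>) (\<lambda>t. f t + g t) u" if "u \<in> {a..b}" for u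
    using pos that by (rule rl_right_int_exists_continuous)
  with lin show "rl_right_deriv_exists a b \<gamma> (\<lambda>t. f t + g t) x"
    by (simp add: rl_right_deriv_exists_def ge nat_ceiling_eq[OF \<gamma>])
  from lin show "rl_right_deriv a b \<gamma> (\<lambda>t. f t + g t) x = rl_right_deriv a b \<gamma> f x + rl_right_deriv a b \<gamma> g x"
    by (simp add: rl_right_deriv_def ge nat_ceiling_eq[OF \<gamma>] distrib_left[of "(-1) ^ k"] add_divide_distrib)
qed

text \<open>Fractional integration by parts transfers the left integrals from the test function to
  the coefficients. The higher-order du Bois-Reymond lemma then applies, and existence of the right
  derivatives is used only at the point considered.\<close>

lemma fractional_stationarity:
  fixes G W :: "real \<Rightarrow> real" and A :: "nat \<Rightarrow> real \<Rightarrow> real"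
  assumes "a < b" "\<beta> > 0" and \<alpha>: "\<And>k. k \<in> {1..n} \<Longrightarrow> \<alpha> k \<in> {real k - 1<..<real k}"
    and G: "continuous_on {a..b} G" and W: "continuous_on {a..b} W"
    and A: "\<And>k. k \<in> {1..n} \<Longrightarrow> continuous_on {a..b} (A k)"
    and zero: "\<And>H. derivative_chain a b n H \<Longrightarrow>
      integral {a..b} (\<lambda>x. G x * H 0 x + (\<Sum>k=1..n. A k x * rl_left_int a (real k - \<alpha> k) (H k) x)
                           + W x * rl_left_int a \<beta> (H 0) x) = 0"
  shows "x \<in> {a..b} \<Longrightarrow> (\<And>k. k \<in> {1..n} \<Longrightarrow> rl_right_deriv_exists a b (\<alpha> k) (A k) x) \<Longrightarrow>
      G x + (\<Sum>k=1..n. rl_right_deriv a b (\<alpha> k) (A k) x) + rl_right_int b \<beta> W x = 0"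
    and "k \<in> {1..n} \<Longrightarrow> x \<in> {a, b} \<Longrightarrow>
      (\<And>m. m \<in> {k..n} \<Longrightarrow> rl_right_deriv_exists a b (\<alpha> m - real k) (A m) x) \<Longrightarrow>
      (\<Sum>m=k..n. rl_right_deriv a b (\<alpha> m - real k) (A m) x) = 0"
proof -
  let ?S = "{a..b}"
  \<comment> \<open>The integral of order \<open>\<beta>\<close> acts on \<open>H 0\<close> itself,
    so its transpose joins \<open>G\<close> in the coefficient of order zero.\<close>
  define \<Psi> where "\<Psi> k = (if k = 0 then (\<lambda>x. G x + rl_right_int b \<beta> W x)
     else rl_right_int b (real k - \<alpha> k) (A k))" for k
  have \<alpha>pos: "real k - \<alpha> k > 0" if "k \<in> {1..n}" for k using \<alpha>[OF that] by auto
  have \<Psi>c: "continuous_on ?S (\<Psi> k)" if "k \<le> n" for k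
    using that assms(2) \<alpha>pos[of k]
    by (auto simp: \<Psi>_def intro!: continuous_intros G W A continuous_on_rl_right_int)
  have \<Psi>zero: "(\<Sum>k\<le>n. integral ?S (\<lambda>x. \<Psi> k x * H k x)) = 0"
    if Hc: "\<And>k. k \<le> n \<Longrightarrow> continuous_on ?S (H k)"
      and H': "\<And>k x. k < n \<Longrightarrow> x \<in> ?S \<Longrightarrow> (H k has_vector_derivative H (Suc k) x) (at x within ?S)"
    for H :: "nat \<Rightarrow> real \<Rightarrow> real"
  proof -
    note [continuous_intros] = continuous_on_rl_left_int continuous_on_rl_right_int
    have "integral ?S (\<lambda>x. G x * H 0 x + (\<Sum>k=1..n. A k x * rl_left_int a (real k - \<alpha> k) (H k) x)
                           + W x * rl_left_int a \<beta> (H 0) x)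
       = integral ?S (\<lambda>x. G x * H 0 x)
         + (\<Sum>k=1..n. integral ?S (\<lambda>x. A k x * rl_left_int a (real k - \<alpha> k) (H k) x))
         + integral ?S (\<lambda>x. W x * rl_left_int a \<beta> (H 0) x)"
      using assms(2) \<alpha>pos
      by (subst integral_add integral_sum; 
          auto intro!: integrable_continuous_real continuous_intros G W A Hc integrable_sum)+
    also have "(\<Sum>k=1..n. integral ?S (\<lambda>x. A k x * rl_left_int a (real k - \<alpha> k) (H k) x))
        = (\<Sum>k=1..n. integral ?S (\<lambda>x. \<Psi> k x * H k x))"
      using \<alpha>pos by (intro sum.cong refl) (auto simp: \<Psi>_def intro!: integral_mult_rl_left_int A Hc)
    also have "integral ?S (\<lambda>x. W x * rl_left_int a \<beta> (H 0) x) = integral ?S (\<lambda>x. rl_right_int b \<beta> W x * H 0 x)"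
      by (intro integral_mult_rl_left_int W Hc assms(2)) simp
    also have "integral ?S (\<lambda>x. G x * H 0 x) + (\<Sum>k=1..n. integral ?S (\<lambda>x. \<Psi> k x * H k x)) + \<dots>
       = integral ?S (\<lambda>x. \<Psi> 0 x * H 0 x) + (\<Sum>k=1..n. integral ?S (\<lambda>x. \<Psi> k x * H k x))"
      unfolding \<Psi>_def using assms(2)
      by (simp add: distrib_right, subst integral_add;
          auto intro!: integrable_continuous_real continuous_intros G W Hc)
    also have "\<dots> = (\<Sum>k\<le>n. integral ?S (\<lambda>x. \<Psi> k x * H k x))"
      by (simp add: atMost_atLeast0 sum.atLeast_Suc_atMost)
    finally show ?thesis using zero[of H] Hc H' by (simp add: derivative_chain_def)
  qed
  let ?Q = "accumulated_coeff b \<Psi>"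
  have du: "?Q n x = 0" if "x \<in> ?S" for x
    by (rule higher_order_du_Bois_Reymond(1)[OF assms(1) _ _ that]) (fact \<Psi>c \<Psi>zero)+
  have du': "integral ?S (?Q k) = 0" if "k < n" for k
    by (rule higher_order_du_Bois_Reymond(2)[OF assms(1) _ _ that]) (fact \<Psi>c \<Psi>zero)+
  have Q: "?Q k x + (\<Sum>m\<in>{k<..n}. (-1) ^ (m - k) * nderiv ?S (m - k) (\<Psi> m) x) = 0"
    if "k \<le> n" "x \<in> ?S" "\<And>m. m \<in> {k<..n} \<Longrightarrow> ntimes_differentiable_at ?S (m - k) (\<Psi> m) x" for k x
    using that by (intro accumulated_coeff_nderiv[OF assms(1) \<Psi>c du])
  \<comment> \<open>The order \<open>\<alpha> m - real k\<close> lies between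
    \<open>m - k - 1\<close> and \<open>m - k\<close>, and its distance to \<open>m - k\<close> is
    again \<open>real m - \<alpha> m\<close>. The inner fractional integral is therefore
    \<open>\<Psi> m\<close>, whatever \<open>k\<close> is.\<close>
  have deriv: "ntimes_differentiable_at ?S (m - k) (\<Psi> m) x"
    "rl_right_deriv a b (\<alpha> m - real k) (A m) x = (-1) ^ (m - k) * nderiv ?S (m - k) (\<Psi> m) x"
    if "m \<in> {k<..n}" "x \<in> ?S" "rl_right_deriv_exists a b (\<alpha> m - real k) (A m) x" for k m x
    using rl_right_deriv_eq_nderiv[OF assms(1) that(2) _ _ that(3), of "m - k"] that(1) \<alpha>[of m]
    by (auto simp: \<Psi>_def of_nat_diff)
  show "G x + (\<Sum>k=1..n. rl_right_deriv a b (\<alpha> k) (A k) x) + rl_right_int b \<beta> W x = 0"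
    if x: "x \<in> ?S" and ex: "\<And>k. k \<in> {1..n} \<Longrightarrow> rl_right_deriv_exists a b (\<alpha> k) (A k) x"
  proof -
    have "(\<Sum>k=1..n. rl_right_deriv a b (\<alpha> k) (A k) x)
        = (\<Sum>m\<in>{0<..n}. (-1) ^ (m - 0) * nderiv ?S (m - 0) (\<Psi> m) x)"
      using deriv(2)[of _ 0 x] x ex by (intro sum.cong) auto
    moreover have "?Q 0 x + (\<Sum>m\<in>{0<..n}. (-1) ^ (m - 0) * nderiv ?S (m - 0) (\<Psi> m) x) = 0"
      using deriv(1)[of _ 0 x] x ex by (intro Q) auto
    ultimately show ?thesis by (simp add: \<Psi>_def)
  qed
  show "(\<Sum>m=k..n. rl_right_deriv a b (\<alpha> m - real k) (A m) x) = 0"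
    if k: "k \<in> {1..n}" and x: "x \<in> {a, b}"
      and ex: "\<And>m. m \<in> {k..n} \<Longrightarrow> rl_right_deriv_exists a b (\<alpha> m - real k) (A m) x"
  proof -
    obtain i where i: "k = Suc i" "i < n" using k by (cases k) auto
    have xS: "x \<in> ?S" using x assms(1) by auto
    \<comment> \<open>At \<open>x = b\<close> the domain is a single point; at \<open>x = a\<close>
      this is the integral condition from the du Bois-Reymond lemma. Each end point is thus settled
      separately.\<close>
    have "integral {x..b} (?Q i) = 0" using x du'[OF i(2)] by auto
    then have Qk: "?Q k x = \<Psi> k x" by (simp add: i)
    have "(\<Sum>m=k..n. rl_right_deriv a b (\<alpha> m - real k) (A m) x)
       = rl_right_deriv a b (\<alpha> k - real k) (A k) x
         + (\<Sum>m\<in>{k<..n}. rl_right_deriv a b (\<alpha> m - real k) (A m) x)"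
      using k by (simp add: sum.atLeast_Suc_atMost atLeastSucAtMost_greaterThanAtMost)
    \<comment> \<open>For \<open>m = k\<close> the order is negative, so the derivative denotes the
      fractional integral of order \<open>real k - \<alpha> k\<close>.\<close>
    also have "rl_right_deriv a b (\<alpha> k - real k) (A k) x = ?Q k x"
      using \<alpha>[OF k] k by (simp add: rl_right_deriv_def Qk \<Psi>_def)
    also have "(\<Sum>m\<in>{k<..n}. rl_right_deriv a b (\<alpha> m - real k) (A m) x)
        = (\<Sum>m\<in>{k<..n}. (-1) ^ (m - k) * nderiv ?S (m - k) (\<Psi> m) x)"
      using deriv(2)[of _ k x] xS ex by (intro sum.cong) auto
    also have "?Q k x + \<dots> = 0"
      using k deriv(1)[of _ k x] xS ex by (intro Q) auto
    finally show ?thesis .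
  qed
qed

section \<open>The functional along admissible variations\<close>

lemma continuous_on_caputo_vec:
  assumes "\<And>k. k \<in> {1..n} \<Longrightarrow> continuous_on S (caputo a b (\<alpha> k) y)"
  shows "continuous_on S (caputo_vec n e a b \<alpha> y)"
  unfolding caputo_vec_def [abs_def] using assms by (intro continuous_intros) auto

lemma continuous_on_brace:
  assumes "y \<in> F_class n a b \<alpha> \<beta>" "n \<ge> 1"
  shows "continuous_on {a..b} (brace n e a b \<alpha> \<beta> y)"
proof -
  have "continuous_on {a..b} (nderiv {a..b} 0 y)"
    using assms unfolding F_class_def AC_def mem_Collect_eq by (metis One_nat_def Suc_le_lessD)
  with assms show ?thesis
    unfolding brace_def [abs_def]
    by (intro continuous_intros continuous_on_caputo_vec) (auto simp: F_class_def)
qed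

text \<open>A linear regrouping that turns \<open>brace\<close> paired with \<open>z_fun\<close>
  into \<open>bracket\<close>; it is the map \<open>j\<close> of
  \<open>first_variation\<close>.\<close>

definition insert_z :: "(real \<times> real \<times> 'v::euclidean_space \<times> real) \<times> real \<Rightarrow> real \<times> real \<times> 'v \<times> real \<times> real" where
  "insert_z = (\<lambda>((x, y, v, w), z). (x, y, v, w, z))"

lemma bounded_linear_insert_z: "bounded_linear insert_z"
  by (intro linear_conv_bounded_linear[THEN iffD1] linearI) (auto simp: insert_z_def)

lemma z_fun_eq_integral:
  assumes "y \<in> F_class n a b \<alpha> \<beta>" "n \<ge> 1" "x \<in> {a..b}"
    and l: "continuous_on ({a..b} \<times> UNIV) l"
  shows "z_fun n e a b \<alpha> \<beta> l y x = integral {a..x} (\<lambda>t. l (brace n e a b \<alpha> \<beta> y t))"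
proof -
  have "continuous_on {a..b} (\<lambda>t. l (brace n e a b \<alpha> \<beta> y t))"
    by (rule continuous_on_compose2[OF l continuous_on_brace[OF assms(1,2)]]) (auto simp: brace_def)
  then have "continuous_on {a..x} (\<lambda>t. l (brace n e a b \<alpha> \<beta> y t))"
    by (rule continuous_on_subset) (use assms in auto)
  from set_lebesgue_integral_eq_integral(2)[OF absolutely_integrable_continuous_real[OF this]]
  show ?thesis by (simp add: z_fun_def)
qed

lemma continuous_on_z_fun:
  assumes "y \<in> F_class n a b \<alpha> \<beta>" "n \<ge> 1"
    and l: "continuous_on ({a..b} \<times> UNIV) l"
  shows "continuous_on {a..b} (z_fun n e a b \<alpha> \<beta> l y)"
proof -
  have "continuous_on {a..b} (\<lambda>t. l (brace n e a b \<alpha> \<beta> y t))"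
    by (rule continuous_on_compose2[OF l continuous_on_brace[OF assms(1,2)]]) (auto simp: brace_def)
  then have "continuous_on {a..b} (\<lambda>x. integral {a..x} (\<lambda>t. l (brace n e a b \<alpha> \<beta> y t)))"
    by (intro indefinite_integral_continuous_1 integrable_continuous_real)
  then show ?thesis
    by (rule continuous_on_eq) (simp add: z_fun_eq_integral[OF assms(1,2) _ l])
qed

lemma bracket_eq_insert_z:
  "bracket n e a b \<alpha> \<beta> l y x = insert_z (brace n e a b \<alpha> \<beta> y x, z_fun n e a b \<alpha> \<beta> l y x)"
  by (simp add: bracket_def brace_def insert_z_def)

lemma continuous_on_bracket:
  assumes "y \<in> F_class n a b \<alpha> \<beta>" "n \<ge> 1"
    and l: "continuous_on ({a..b} \<times> UNIV) l"
  shows "continuous_on {a..b} (bracket n e a b \<alpha> \<beta> l y)"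
  unfolding bracket_eq_insert_z [abs_def]
  by (intro bounded_linear.continuous_on[OF bounded_linear_insert_z] continuous_on_Pair
      continuous_on_brace continuous_on_z_fun assms)

lemma J_functional_eq_integral:
  assumes "y \<in> F_class n a b \<alpha> \<beta>" "n \<ge> 1"
    and l: "continuous_on ({a..b} \<times> UNIV) l" and L: "continuous_on ({a..b} \<times> UNIV) L"
  shows "J_functional n e a b \<alpha> \<beta> L l y = integral {a..b} (\<lambda>x. L (bracket n e a b \<alpha> \<beta> l y x))"
proof -
  have "continuous_on {a..b} (\<lambda>x. L (bracket n e a b \<alpha> \<beta> l y x))"
    by (rule continuous_on_compose2[OF L continuous_on_bracket[OF assms(1,2) l]]) (auto simp: bracket_def)
  from set_lebesgue_integral_eq_integral(2)[OF absolutely_integrable_continuous_real[OF this]]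
  show ?thesis by (simp add: J_functional_def)
qed

text \<open>The direction in which \<open>brace\<close> moves when \<open>H 0\<close> is added to
  the function. Its first entry is zero because \<open>x\<close> is not varied, and its vector entry
  consists of the Caputo derivatives of \<open>H 0\<close>, expressed through
  \<open>H k\<close>.\<close>

definition variation ::
  "nat \<Rightarrow> (nat \<Rightarrow> 'n::finite) \<Rightarrow> real \<Rightarrow> (nat \<Rightarrow> real) \<Rightarrow> real \<Rightarrow> (nat \<Rightarrow> real \<Rightarrow> real) \<Rightarrow> real
    \<Rightarrow> real \<times> real \<times> (real ^ 'n) \<times> real" where
  "variation n e a \<alpha> \<beta> H x = (0, H 0 x,
     \<Sum>k=1..n. rl_left_int a (real k - \<alpha> k) (H k) x *\<^sub>R axis (e k) 1, rl_left_int a \<beta> (H 0) x)"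

lemma brace_add_scaled_chain:
  assumes "a < b" "\<beta> > 0" and \<alpha>: "\<And>k. k \<in> {1..n} \<Longrightarrow> \<alpha> k \<in> {real k - 1<..<real k}"
    and y: "y \<in> F_class n a b \<alpha> \<beta>" and H: "derivative_chain a b n H" and x: "x \<in> {a..b}"
  shows "brace n e a b \<alpha> \<beta> (\<lambda>t. y t + \<epsilon> * H 0 t) x
       = brace n e a b \<alpha> \<beta> y x + \<epsilon> *\<^sub>R variation n e a \<alpha> \<beta> H x"
proof -
  have "caputo a b (\<alpha> k) (\<lambda>t. y t + \<epsilon> * H 0 t) x
      = caputo a b (\<alpha> k) y x + \<epsilon> * rl_left_int a (real k - \<alpha> k) (H k) x" if "k \<in> {1..n}" for k
    using y x that by (intro caputo_add_scaled_chain(2)[OF assms(1) x \<alpha> _ _ _ H]) (auto simp: F_class_def)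
  then have "caputo_vec n e a b \<alpha> (\<lambda>t. y t + \<epsilon> * H 0 t) x
      = caputo_vec n e a b \<alpha> y x + \<epsilon> *\<^sub>R (\<Sum>k=1..n. rl_left_int a (real k - \<alpha> k) (H k) x *\<^sub>R axis (e k) 1)"
    by (simp add: caputo_vec_def scaleR_add_left sum.distrib scaleR_sum_right)
  moreover have "rl_left_int a \<beta> (\<lambda>t. y t + \<epsilon> * H 0 t) x = rl_left_int a \<beta> y x + \<epsilon> * rl_left_int a \<beta> (H 0) x"
    using y x H by (intro rl_left_int_add_scaled(2)[OF assms(1) x assms(2)]) (auto simp: F_class_def derivative_chain_def)
  ultimately show ?thesis by (simp add: brace_def variation_def)
qed

lemma continuous_on_variation:
  assumes "\<beta> > 0" and \<alpha>: "\<And>k. k \<in> {1..n} \<Longrightarrow> \<alpha> k \<in> {real k - 1<..<real k}"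
    and H: "derivative_chain a b n H"
  shows "continuous_on {a..b} (variation n e a \<alpha> \<beta> H)"
  unfolding variation_def [abs_def]
  using assms by (intro continuous_intros continuous_on_rl_left_int) (auto simp: derivative_chain_def)

text \<open>Perturbing the minimizer moves \<open>brace\<close> along a straight line, as
  \<open>first_variation\<close> expects. The zero first entry of \<open>variation\<close> keeps
  that line inside \<open>{a..b} \<times> UNIV\<close>.\<close>

lemma minimizer_first_variation:
  fixes l' :: "real \<times> real \<times> (real ^ 'n) \<times> real \<Rightarrow> (real \<times> real \<times> (real ^ 'n::finite) \<times> real) \<Rightarrow>\<^sub>L real"
    and L' :: "real \<times> real \<times> (real ^ 'n) \<times> real \<times> real \<Rightarrow> (real \<times> real \<times> (real ^ 'n) \<times> real \<times> real) \<Rightarrow>\<^sub>L real"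
  assumes "a < b" "n \<ge> 1" "\<beta> > 0" and \<alpha>: "\<And>k. k \<in> {1..n} \<Longrightarrow> \<alpha> k \<in> {real k - 1<..<real k}"
    and min: "is_arg_min (J_functional n e a b \<alpha> \<beta> L l) (\<lambda>h. h \<in> F_class n a b \<alpha> \<beta>) y"
    and l: "\<And>u. u \<in> {a..b} \<times> UNIV \<Longrightarrow> (l has_derivative l' u) (at u within {a..b} \<times> UNIV)"
    and l'c: "continuous_on ({a..b} \<times> UNIV) l'"
    and L: "\<And>u. u \<in> {a..b} \<times> UNIV \<Longrightarrow> (L has_derivative L' u) (at u within {a..b} \<times> UNIV)"
    and L'c: "continuous_on ({a..b} \<times> UNIV) L'"
    and H: "derivative_chain a b n H"
  shows "integral {a..b} (\<lambda>x. L' (bracket n e a b \<alpha> \<beta> l y x) (insert_z (variation n e a \<alpha> \<beta> H x,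
      integral {a..x} (\<lambda>t. l' (brace n e a b \<alpha> \<beta> y t) (variation n e a \<alpha> \<beta> H t))))) = 0"
proof -
  let ?p = "brace n e a b \<alpha> \<beta> y" and ?q = "variation n e a \<alpha> \<beta> H"
  have y: "y \<in> F_class n a b \<alpha> \<beta>" using min by (simp add: is_arg_min_def)
  have lc: "continuous_on ({a..b} \<times> UNIV) l" by (rule has_derivative_continuous_on) (rule l)
  have Lc: "continuous_on ({a..b} \<times> UNIV) L" by (rule has_derivative_continuous_on) (rule L)
  have pq: "?p x + \<epsilon> *\<^sub>R ?q x \<in> {a..b} \<times> UNIV" if "x \<in> {a..b}" for x \<epsilon>
    using that by (simp add: brace_def variation_def)
  have J: "J_functional n e a b \<alpha> \<beta> L l (\<lambda>t. y t + \<epsilon> * H 0 t)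
     = integral {a..b} (\<lambda>x. L (insert_z (?p x + \<epsilon> *\<^sub>R ?q x, integral {a..x} (\<lambda>t. l (?p t + \<epsilon> *\<^sub>R ?q t)))))" for \<epsilon>
  proof -
    let ?y = "\<lambda>t. y t + \<epsilon> * H 0 t"
    have Y: "?y \<in> F_class n a b \<alpha> \<beta>" by (rule F_class_add_scaled_chain[OF assms(1-4) y H])
    have br: "brace n e a b \<alpha> \<beta> ?y x = ?p x + \<epsilon> *\<^sub>R ?q x" if "x \<in> {a..b}" for x
      by (rule brace_add_scaled_chain[OF assms(1,3) \<alpha> y H that])
    have z: "z_fun n e a b \<alpha> \<beta> l ?y x = integral {a..x} (\<lambda>t. l (?p t + \<epsilon> *\<^sub>R ?q t))" if "x \<in> {a..b}" for x
      unfolding z_fun_eq_integral[OF Y assms(2) that lc]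
    proof (rule integral_cong)
      fix t assume "t \<in> {a..x}"
      then have "t \<in> {a..b}" using that by auto
      then show "l (brace n e a b \<alpha> \<beta> ?y t) = l (?p t + \<epsilon> *\<^sub>R ?q t)" by (simp add: br)
    qed
    show ?thesis
      unfolding J_functional_eq_integral[OF Y assms(2) lc Lc] bracket_eq_insert_z
      by (rule integral_cong) (simp add: br z)
  qed
  have "integral {a..b} (\<lambda>x. L' (insert_z (?p x, integral {a..x} (\<lambda>t. l (?p t))))
       (insert_z (?q x, integral {a..x} (\<lambda>t. l' (?p t) (?q t))))) = 0"
  proof (rule first_variation[OF assms(1) bounded_linear_insert_z continuous_on_brace[OF y assms(2)]
        continuous_on_variation[OF assms(3,4) H] pq _ l l'c L L'c])
    show "insert_z (?p x + \<epsilon> *\<^sub>R ?q x, z) \<in> {a..b} \<times> UNIV" if "x \<in> {a..b}" for x \<epsilon> z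
      using that by (simp add: brace_def variation_def insert_z_def)
    show "integral {a..b} (\<lambda>x. L (insert_z (?p x, integral {a..x} (\<lambda>t. l (?p t)))))
       \<le> integral {a..b} (\<lambda>x. L (insert_z (?p x + \<epsilon> *\<^sub>R ?q x, integral {a..x} (\<lambda>t. l (?p t + \<epsilon> *\<^sub>R ?q t)))))" for \<epsilon>
      using min F_class_add_scaled_chain[OF assms(1-4) y H, of \<epsilon>] J[of \<epsilon>] J[of 0]
      by (auto simp: is_arg_min_def not_less)
  qed auto
  also have "integral {a..b} (\<lambda>x. L' (insert_z (?p x, integral {a..x} (\<lambda>t. l (?p t))))
       (insert_z (?q x, integral {a..x} (\<lambda>t. l' (?p t) (?q t)))))
     = integral {a..b} (\<lambda>x. L' (bracket n e a b \<alpha> \<beta> l y x) (insert_z (?q x, integral {a..x} (\<lambda>t. l' (?p t) (?q t)))))"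
    by (rule integral_cong) (simp add: bracket_eq_insert_z z_fun_eq_integral[OF y assms(2) _ lc])
  finally show ?thesis .
qed

lemma blinfun_variation:
  fixes T :: "(real \<times> real \<times> (real ^ 'n::finite) \<times> real) \<Rightarrow>\<^sub>L real"
  shows "T (variation n e a \<alpha> \<beta> H x) = T (0, 1, 0, 0) * H 0 x
     + (\<Sum>k=1..n. T (0, 0, axis (e k) 1, 0) * rl_left_int a (real k - \<alpha> k) (H k) x)
     + T (0, 0, 0, 1) * rl_left_int a \<beta> (H 0) x"
proof -
  have "variation n e a \<alpha> \<beta> H x = H 0 x *\<^sub>R (0, 1, 0, 0)
     + (\<Sum>k=1..n. rl_left_int a (real k - \<alpha> k) (H k) x *\<^sub>R (0, 0, axis (e k) 1, 0))
     + rl_left_int a \<beta> (H 0) x *\<^sub>R (0, 0, 0, 1)"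
    by (simp add: variation_def prod_eq_iff fst_sum snd_sum)
  then show ?thesis
    by (simp only: blinfun.add_right blinfun.scaleR_right blinfun.sum_right real_scaleR_def mult.commute)
qed

lemma blinfun_insert_z_variation:
  fixes T :: "(real \<times> real \<times> (real ^ 'n::finite) \<times> real \<times> real) \<Rightarrow>\<^sub>L real"
  shows "T (insert_z (variation n e a \<alpha> \<beta> H x, \<zeta>)) = T (0, 1, 0, 0, 0) * H 0 x
     + (\<Sum>k=1..n. T (0, 0, axis (e k) 1, 0, 0) * rl_left_int a (real k - \<alpha> k) (H k) x)
     + T (0, 0, 0, 1, 0) * rl_left_int a \<beta> (H 0) x + T (0, 0, 0, 0, 1) * \<zeta>"
proof -
  have "insert_z (variation n e a \<alpha> \<beta> H x, \<zeta>) = H 0 x *\<^sub>R (0, 1, 0, 0, 0)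
     + (\<Sum>k=1..n. rl_left_int a (real k - \<alpha> k) (H k) x *\<^sub>R (0, 0, axis (e k) 1, 0, 0))
     + rl_left_int a \<beta> (H 0) x *\<^sub>R (0, 0, 0, 1, 0) + \<zeta> *\<^sub>R (0, 0, 0, 0, 1)"
    by (simp add: insert_z_def variation_def prod_eq_iff fst_sum snd_sum)
  then show ?thesis
    by (simp only: blinfun.add_right blinfun.scaleR_right blinfun.sum_right real_scaleR_def mult.commute)
qed

section \<open>The Euler--Lagrange equation and the natural boundary conditions\<close>

theorem theorem20:
  fixes a b \<beta> :: real and n :: nat and \<alpha> :: "nat \<Rightarrow> real"
    and e :: "nat \<Rightarrow> 'n::finite"
    and L :: "real \<times> real \<times> (real ^ 'n) \<times> real \<times> real \<Rightarrow> real"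
    and l :: "real \<times> real \<times> (real ^ 'n) \<times> real \<Rightarrow> real"
    and y :: "real \<Rightarrow> real"
  assumes "a < b"
    and "bij_betw e {1..n} UNIV"
    and "\<beta> > 0"
    and "\<And>k. k \<in> {1..n} \<Longrightarrow> \<alpha> k \<in> {real k - 1<..<real k}"
    and "C1_on ({a..b} \<times> UNIV) L"
    and "C1_on ({a..b} \<times> UNIV) l"
    and "is_arg_min (J_functional n e a b \<alpha> \<beta> L l) (\<lambda>h. h \<in> F_class n a b \<alpha> \<beta>) y"
  shows
    "let B = bracket n e a b \<alpha> \<beta> l y;
         C = brace n e a b \<alpha> \<beta> y;
         L_y = (\<lambda>x. partial_deriv (0, 1, 0, 0, 0) L (B x));
         L_v = (\<lambda>k x. partial_deriv (0, 0, axis (e k) 1, 0, 0) L (B x));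
         L_w = (\<lambda>x. partial_deriv (0, 0, 0, 1, 0) L (B x));
         L_z = (\<lambda>x. partial_deriv (0, 0, 0, 0, 1) L (B x));
         l_y = (\<lambda>x. partial_deriv (0, 1, 0, 0) l (C x));
         l_v = (\<lambda>k x. partial_deriv (0, 0, axis (e k) 1, 0) l (C x));
         l_w = (\<lambda>x. partial_deriv (0, 0, 0, 1) l (C x));
         I_z = (\<lambda>x. LINT t:{x..b}|lebesgue. L_z t)
     in
       (\<forall>x\<in>{a..b}.
          (\<forall>k\<in>{1..n}. rl_right_deriv_exists a b (\<alpha> k) (L_v k) x \<and>
                      rl_right_deriv_exists a b (\<alpha> k) (\<lambda>t. I_z t * l_v k t) x) \<longrightarrow>
          L_y x
          + (\<Sum>k=1..n. rl_right_deriv a b (\<alpha> k) (L_v k) x)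
          + rl_right_int b \<beta> L_w x
          + I_z x * l_y x
          + (\<Sum>k=1..n. rl_right_deriv a b (\<alpha> k) (\<lambda>t. I_z t * l_v k t) x)
          + rl_right_int b \<beta> (\<lambda>t. I_z t * l_w t) x = 0) \<and>
       (\<forall>k\<in>{1..n}.
          (\<forall>m\<in>{k..n}. \<forall>x\<in>{a, b}.
             rl_right_deriv_exists a b (\<alpha> m - real k) (\<lambda>t. L_v m t + I_z t * l_v m t) x) \<longrightarrow>
          (\<Sum>m=k..n.
             rl_right_deriv a b (\<alpha> m - real k) (\<lambda>t. L_v m t + I_z t * l_v m t) b
             - rl_right_deriv a b (\<alpha> m - real k) (\<lambda>t. L_v m t + I_z t * l_v m t) a) = 0)"
proof -
  let ?S = "{a..b}"
  \<comment> \<open>A type is never empty, so the empty set \<open>{1..0}\<close> cannot be in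
    bijection with the index type.\<close>
  have n: "n \<ge> 1"
  proof (rule ccontr)
    assume "\<not> n \<ge> 1"
    then show False using assms(2) by (auto simp: bij_betw_def)
  qed
  define B where "B = bracket n e a b \<alpha> \<beta> l y"
  define C where "C = brace n e a b \<alpha> \<beta> y"
  define L_y where "L_y = (\<lambda>x. partial_deriv (0, 1, 0, 0, 0) L (B x))"
  define L_v where "L_v = (\<lambda>k x. partial_deriv (0, 0, axis (e k) 1, 0, 0) L (B x))"
  define L_w where "L_w = (\<lambda>x. partial_deriv (0, 0, 0, 1, 0) L (B x))"
  define L_z where "L_z = (\<lambda>x. partial_deriv (0, 0, 0, 0, 1) L (B x))"
  define l_y where "l_y = (\<lambda>x. partial_deriv (0, 1, 0, 0) l (C x))"
  define l_v where "l_v = (\<lambda>k x. partial_deriv (0, 0, axis (e k) 1, 0) l (C x))"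
  define l_w where "l_w = (\<lambda>x. partial_deriv (0, 0, 0, 1) l (C x))"
  define I_z where "I_z = (\<lambda>x. LINT t:{x..b}|lebesgue. L_z t)"
  note defs = B_def C_def L_y_def L_v_def L_w_def L_z_def l_y_def l_v_def l_w_def I_z_def
  obtain L' where L: "\<And>u. u \<in> ?S \<times> UNIV \<Longrightarrow> (L has_derivative blinfun_apply (L' u)) (at u within ?S \<times> UNIV)"
    and L'c: "continuous_on (?S \<times> UNIV) L'" using assms(5) unfolding C1_on_def by blast
  obtain l' where l: "\<And>u. u \<in> ?S \<times> UNIV \<Longrightarrow> (l has_derivative blinfun_apply (l' u)) (at u within ?S \<times> UNIV)"
    and l'c: "continuous_on (?S \<times> UNIV) l'" using assms(6) unfolding C1_on_def by blast
  have y: "y \<in> F_class n a b \<alpha> \<beta>" using assms(7) by (simp add: is_arg_min_def)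
  have lc: "continuous_on (?S \<times> UNIV) l" by (rule has_derivative_continuous_on) (rule l)
  have Bin: "B x \<in> ?S \<times> UNIV" and Cin: "C x \<in> ?S \<times> UNIV" if "x \<in> ?S" for x
    using that by (simp_all add: B_def C_def bracket_def brace_def)
  then have BS: "B ` ?S \<subseteq> ?S \<times> UNIV" and CS: "C ` ?S \<subseteq> ?S \<times> UNIV" by blast+
  have Bc: "continuous_on ?S B" unfolding B_def by (rule continuous_on_bracket[OF y n lc])
  have Cc: "continuous_on ?S C" unfolding C_def by (rule continuous_on_brace[OF y n])
  have L_part: "partial_deriv u L (B x) = L' (B x) u" if "fst u = 0" "x \<in> ?S" for u x
    using partial_deriv_eq[OF L[OF Bin[OF that(2)]] that(1) Bin[OF that(2)]] .
  have l_part: "partial_deriv u l (C x) = l' (C x) u" if "fst u = 0" "x \<in> ?S" for u x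
    using partial_deriv_eq[OF l[OF Cin[OF that(2)]] that(1) Cin[OF that(2)]] .
  have L_cont: "continuous_on ?S (\<lambda>x. partial_deriv u L (B x))" if "fst u = 0" for u
  proof (rule continuous_on_eq)
    show "continuous_on ?S (\<lambda>x. L' (B x) u)"
      by (intro continuous_intros continuous_on_compose2[OF L'c Bc BS])
  qed (simp add: L_part that)
  have l_cont: "continuous_on ?S (\<lambda>x. partial_deriv u l (C x))" if "fst u = 0" for u
  proof (rule continuous_on_eq)
    show "continuous_on ?S (\<lambda>x. l' (C x) u)"
      by (intro continuous_intros continuous_on_compose2[OF l'c Cc CS])
  qed (simp add: l_part that)
  have c [continuous_intros]: "continuous_on ?S L_y" "continuous_on ?S (L_v k)" "continuous_on ?S L_w"
    "continuous_on ?S L_z" "continuous_on ?S l_y" "continuous_on ?S (l_v k)" "continuous_on ?S l_w" for k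
    unfolding L_y_def L_v_def L_w_def L_z_def l_y_def l_v_def l_w_def
    by (intro L_cont l_cont; simp)+
  have I_z: "I_z x = integral {x..b} L_z" if "x \<in> ?S" for x
    unfolding I_z_def using that
    by (intro set_lebesgue_integral_eq_integral(2) absolutely_integrable_continuous_real
        continuous_on_subset[OF c(4)]) auto
  have I_zc [continuous_intros]: "continuous_on ?S I_z"
    by (rule continuous_on_eq[OF indefinite_integral_continuous_1'[OF integrable_continuous_real[OF c(4)]]])
       (simp add: I_z)
  \<comment> \<open>\<open>I_z\<close> is the weight that the variation of \<open>l\<close> acquires
    once the integral defining \<open>z\<close> has been removed by parts.\<close>
  define G where "G x = L_y x + I_z x * l_y x" for x
  define A where "A k x = L_v k x + I_z x * l_v k x" for k x
  define W where "W x = L_w x + I_z x * l_w x" for x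
  have zero: "integral ?S (\<lambda>x. G x * H 0 x + (\<Sum>k=1..n. A k x * rl_left_int a (real k - \<alpha> k) (H k) x)
      + W x * rl_left_int a \<beta> (H 0) x) = 0" if H: "derivative_chain a b n H" for H
  proof -
    have Hc: "continuous_on ?S (H 0)"
      and Ic: "k \<in> {1..n} \<Longrightarrow> continuous_on ?S (rl_left_int a (real k - \<alpha> k) (H k))"
      and I\<beta>: "continuous_on ?S (rl_left_int a \<beta> (H 0))" for k
      using H assms(3,4) by (auto simp: derivative_chain_def intro!: continuous_on_rl_left_int)
    \<comment> \<open>\<open>\<theta>\<close> is the variation of \<open>L\<close> with
      \<open>z\<close> held fixed, and \<open>\<phi>\<close> is the variation of \<open>l\<close>;
      the variation of \<open>z\<close> is the integral of \<open>\<phi>\<close> from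
      \<open>a\<close>.\<close>
    define \<theta> where "\<theta> x = L_y x * H 0 x + (\<Sum>k=1..n. L_v k x * rl_left_int a (real k - \<alpha> k) (H k) x)
        + L_w x * rl_left_int a \<beta> (H 0) x" for x
    define \<phi> where "\<phi> x = l_y x * H 0 x + (\<Sum>k=1..n. l_v k x * rl_left_int a (real k - \<alpha> k) (H k) x)
        + l_w x * rl_left_int a \<beta> (H 0) x" for x
    have \<theta>c: "continuous_on ?S \<theta>" and \<phi>c: "continuous_on ?S \<phi>"
      unfolding \<theta>_def [abs_def] \<phi>_def [abs_def] by (intro continuous_intros Hc Ic I\<beta>; assumption)+
    have \<phi>: "l' (C t) (variation n e a \<alpha> \<beta> H t) = \<phi> t" if "t \<in> ?S" for t
      using that by (simp add: blinfun_variation \<phi>_def l_y_def l_v_def l_w_def l_part)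
    have "0 = integral ?S (\<lambda>x. L' (B x) (insert_z (variation n e a \<alpha> \<beta> H x,
        integral {a..x} (\<lambda>t. l' (C t) (variation n e a \<alpha> \<beta> H t)))))"
      using minimizer_first_variation[OF assms(1) n assms(3,4,7) l l'c L L'c H]
      by (simp add: B_def C_def)
    also have "\<dots> = integral ?S (\<lambda>x. \<theta> x + L_z x * integral {a..x} \<phi>)"
    proof (rule integral_cong)
      fix x assume x: "x \<in> ?S"
      have "integral {a..x} (\<lambda>t. l' (C t) (variation n e a \<alpha> \<beta> H t)) = integral {a..x} \<phi>"
        by (rule integral_cong) (use x in \<open>simp add: \<phi>\<close>)
      with x show "L' (B x) (insert_z (variation n e a \<alpha> \<beta> H x,
        integral {a..x} (\<lambda>t. l' (C t) (variation n e a \<alpha> \<beta> H t)))) = \<theta> x + L_z x * integral {a..x} \<phi>"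
        by (simp add: blinfun_insert_z_variation \<theta>_def L_y_def L_v_def L_w_def L_z_def L_part)
    qed
    also have "\<dots> = integral ?S \<theta> + integral ?S (\<lambda>x. L_z x * integral {a..x} \<phi>)"
      by (intro integral_add integrable_continuous_real continuous_intros \<theta>c
          indefinite_integral_continuous_1 \<phi>c)
    \<comment> \<open>The nested integral is transferred to \<open>L_z\<close>. The boundary term
      vanishes because \<open>integral {a..a} \<phi> = 0\<close>.\<close>
    also have "integral ?S (\<lambda>x. L_z x * integral {a..x} \<phi>) = integral ?S (\<lambda>x. integral {x..b} L_z * \<phi> x)"
      using integral_mult_backward_by_parts[OF _ c(4) \<phi>c integral_has_vector_derivative[OF \<phi>c]] assms(1)
      by simp
    also have "\<dots> = integral ?S (\<lambda>x. I_z x * \<phi> x)"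
      by (rule integral_cong) (simp add: I_z)
    also have "integral ?S \<theta> + \<dots> = integral ?S (\<lambda>x. \<theta> x + I_z x * \<phi> x)"
      by (intro integral_add [symmetric] integrable_continuous_real continuous_intros \<theta>c \<phi>c)
    also have "(\<lambda>x. \<theta> x + I_z x * \<phi> x) = (\<lambda>x. G x * H 0 x
        + (\<Sum>k=1..n. A k x * rl_left_int a (real k - \<alpha> k) (H k) x) + W x * rl_left_int a \<beta> (H 0) x)"
      by (simp add: fun_eq_iff \<theta>_def \<phi>_def G_def A_def W_def algebra_simps sum.distrib sum_distrib_left)
    finally show ?thesis by simp
  qed
  have Gc: "continuous_on ?S G" and Ac: "continuous_on ?S (A k)" and Wc: "continuous_on ?S W" for k
    unfolding G_def [abs_def] A_def [abs_def] W_def [abs_def] by (intro continuous_intros)+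
  note stationary = fractional_stationarity[OF assms(1,3,4) Gc Wc Ac zero]
  have EL: "L_y x + (\<Sum>k=1..n. rl_right_deriv a b (\<alpha> k) (L_v k) x) + rl_right_int b \<beta> L_w x + I_z x * l_y x
      + (\<Sum>k=1..n. rl_right_deriv a b (\<alpha> k) (\<lambda>t. I_z t * l_v k t) x)
      + rl_right_int b \<beta> (\<lambda>t. I_z t * l_w t) x = 0"
    if x: "x \<in> ?S" and ex: "\<forall>k\<in>{1..n}. rl_right_deriv_exists a b (\<alpha> k) (L_v k) x \<and>
      rl_right_deriv_exists a b (\<alpha> k) (\<lambda>t. I_z t * l_v k t) x" for x
  proof -
    have A: "rl_right_deriv_exists a b (\<alpha> k) (A k) x"
      "rl_right_deriv a b (\<alpha> k) (A k) x
        = rl_right_deriv a b (\<alpha> k) (L_v k) x + rl_right_deriv a b (\<alpha> k) (\<lambda>t. I_z t * l_v k t) x"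
      if k: "k \<in> {1..n}" for k
      using rl_right_deriv_add[OF assms(1) x assms(4)[OF k] _ c(2)[of k], of "\<lambda>t. I_z t * l_v k t"] ex k
        continuous_on_mult[OF I_zc c(6)[of k]]
      by (simp_all add: A_def [abs_def])
    have "rl_right_int b \<beta> W x = rl_right_int b \<beta> L_w x + rl_right_int b \<beta> (\<lambda>t. I_z t * l_w t) x"
      unfolding W_def [abs_def] by (intro rl_right_int_add[where a = a] continuous_intros assms(3) x)
    with stationary(1)[OF _ _ x A(1)] show ?thesis
      by (simp add: G_def A(2) sum.distrib)
  qed
  \<comment> \<open>Stationarity makes the sum vanish at \<open>a\<close> and at \<open>b\<close>
    separately, and the difference of the two gives the stated condition.\<close>
  have NBC: "(\<Sum>m=k..n. rl_right_deriv a b (\<alpha> m - real k) (A m) b - rl_right_deriv a b (\<alpha> m - real k) (A m) a) = 0"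
    if k: "k \<in> {1..n}"
      and ex: "\<forall>m\<in>{k..n}. \<forall>x\<in>{a, b}. rl_right_deriv_exists a b (\<alpha> m - real k) (A m) x" for k
    using stationary(2)[OF _ _ k, of a] stationary(2)[OF _ _ k, of b] ex by (simp add: sum_subtractf)
  show ?thesis
    unfolding Let_def
    using EL NBC unfolding A_def [abs_def] defs by blast
qed

end
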